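(* Let $r_1,\ldots,r_6$ be the six unit generating directions of the regular truncated octahedron $O=\sum_{j=1}^6[-r_j/2,r_j/2]$ given in the context, and let $\Gamma_O$ be their correlation graph. The labelled second- and third-order data $\{I_2(r_i,r_j)\}_{i<j}$ and $\{I_3(r_i,r_j,r_k)\}_{i<j<k}$ determine the complete direction family up to independent sign changes and a global orthogonal transformation, i.e. up to $r_i\mapsto\varepsilon_iQr_i$ with $\varepsilon_i\in\{\pm1\}$, $Q\in O(3)$. More precisely, the pair data identify the three orthogonal pairs and determine that every remaining absolute correlation $|r_i\cdot r_j|$ ($i\ne j$) is $1/2$. The eight triangles of $\Gamma_O$ span its full seven-dimensional cycle space over $\mathbb{F}_2$, and their switching classes identify exactly the four coplanar triples (a triangle $ijk$ of $\Gamma_O$ has negative sign, $(r_i\cdot r_j)(r_i\cdot r_k)(r_j\cdot r_k)<0$, if and only if $r_i,r_j,r_k$ are linearly dependent, and this occurs for exactly four of the eight triangles). These four coplanar triples generate the eight hexagonal facets of $O$, and the three orthogonal pairs generate the six square facets.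
   Context: $r_1=\frac{(1,1,0)}{\sqrt2}$, $r_2=\frac{(1,-1,0)}{\sqrt2}$, $r_3=\frac{(1,0,1)}{\sqrt2}$, $r_4=\frac{(1,0,-1)}{\sqrt2}$, $r_5=\frac{(0,1,1)}{\sqrt2}$, $r_6=\frac{(0,1,-1)}{\sqrt2}$. The correlation graph $\Gamma_O$ has vertices $1,\ldots,6$ and an edge $ij$ ($i\ne j$) exactly when $r_i\cdot r_j\ne0$. For unit vectors $n_1,\ldots,n_k$, $I_k(n_1,\ldots,n_k)=\mathbb{E}\prod_{j=1}^k|U\cdot n_j|$ with $U$ uniformly distributed on $S^2$. The switching class of a triangle is the sign of the product of its three correlations, which is invariant under $r_i\mapsto\pm r_i$. A set of generators "generates" a facet of $O$ if the facet is a translate of the Minkowski sum of the corresponding segments $[-r_j/2,r_j/2]$; each such triple (pair) generates an opposite pair of facets. *)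

theory Defs
  imports "HOL-Analysis.Analysis" "HOL-Probability.Probability"
    "HOL-Library.Z2" "HOL-Library.Function_Algebras" "HOL-Library.Set_Algebras"
begin

text \<open>The uniform distribution on \<open>S\<^sup>2\<close> is the radial projection of the uniform distribution on
  the unit ball (the centre, where \<open>sgn 0 = 0\<close>, is a null set). The lemmas below confirm that it
  is an orthogonally invariant probability measure concentrated on the sphere.\<close>

definition unif_sphere :: "(real^3) measure" where
  "unif_sphere = distr (uniform_measure lborel (ball 0 1)) borel sgn"

definition I_mom :: "(real^3) list \<Rightarrow> real" where
  "I_mom ns = (\<integral>u. (\<Prod>n\<leftarrow>ns. \<bar>u \<bullet> n\<bar>) \<partial>unif_sphere)"

lemma sgn_borel [measurable]: "(sgn :: real^3 \<Rightarrow> real^3) \<in> borel_measurable borel"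
  unfolding sgn_div_norm[abs_def] by measurable

lemma emeasure_ball_pos: "emeasure lborel (ball (0::real^3) 1) \<noteq> 0"
  and emeasure_ball_fin: "emeasure lborel (ball (0::real^3) 1) \<noteq> \<infinity>"
proof -
  have "measure lborel (ball (0::real^3) 1) > 0"
    using content_ball_pos[of 1 "0::real^3"] by simp
  then show "emeasure lborel (ball (0::real^3) 1) \<noteq> 0"
    by (auto simp: measure_def)
  show "emeasure lborel (ball (0::real^3) 1) \<noteq> \<infinity>"
    using emeasure_bounded_finite[of "ball (0::real^3) 1"] by auto
qed

lemma prob_space_unif_sphere: "prob_space unif_sphere"
proof -
  interpret prob_space "uniform_measure lborel (ball (0::real^3) 1)"
    using prob_space_uniform_measure[OF emeasure_ball_pos emeasure_ball_fin] .
  show ?thesis unfolding unif_sphere_def by (rule prob_space_distr) measurable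
qed

lemma AE_unif_sphere: "AE u in unif_sphere. u \<in> sphere 0 1"
proof -
  have "AE x in lborel. x \<in> ball (0::real^3) 1 \<longrightarrow> sgn x \<in> sphere (0::real^3) 1"
    using AE_lborel_singleton[of "0::real^3"] by eventually_elim (auto simp: norm_sgn)
  moreover have "{x\<in>space borel. x \<in> sphere (0::real^3) 1} \<in> sets borel"
    using borel_closed[OF closed_sphere] by (simp add: sphere_def)
  ultimately show ?thesis
    unfolding unif_sphere_def
    by (subst AE_distr_iff) (auto intro!: AE_uniform_measureI)
qed

lemma unif_sphere_orthogonal:
  fixes Q :: "real^3 \<Rightarrow> real^3"
  assumes Q: "orthogonal_transformation Q"
  shows "distr unif_sphere borel Q = unif_sphere"
proof (rule measure_eqI)
  have lin: "linear Q" and bij: "bij Q" and nrm: "\<And>x. norm (Q x) = norm x"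
    using Q orthogonal_transformation_bij orthogonal_transformation_norm
    by (auto simp: orthogonal_transformation_def)
  have [measurable]: "Q \<in> borel_measurable borel"
    using lin by (intro borel_measurable_continuous_onI linear_continuous_on linear_linear[THEN iffD1])
      (auto simp: linear_conv_bounded_linear)
  have sg: "sgn (Q x) = Q (sgn x)" for x
    by (simp add: sgn_div_norm nrm linear_cmul[OF lin])
  fix A assume "A \<in> sets (distr unif_sphere borel Q)"
  then have A[measurable]: "A \<in> sets borel" by simp
  define B where "B = ball (0::real^3) 1 \<inter> (sgn -` A)"
  define C where "C = ball (0::real^3) 1 \<inter> (sgn -` (Q -` A))"
  have Bm: "B \<in> sets borel" and Cm: "C \<in> sets borel"
    using measurable_sets_borel[OF sgn_borel A]
      measurable_sets_borel[OF measurable_compose[OF sgn_borel \<open>Q \<in> borel_measurable borel\<close>] A]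
    by (auto simp: B_def C_def vimage_def)
  have "Q ` C = B"
  proof -
    have "x \<in> Q ` C" if "x \<in> B" for x
    proof -
      obtain y where "x = Q y" using bij by (metis bij_pointE)
      with that show ?thesis by (auto simp: B_def C_def sg nrm)
    qed
    then show ?thesis by (auto simp: B_def C_def sg nrm)
  qed
  moreover have lm: "C \<in> lmeasurable" "B \<in> lmeasurable"
    using Bm Cm by (auto intro!: bounded_set_imp_lmeasurable bounded_subset[OF bounded_ball]
      simp: B_def C_def)
  ultimately have "measure lebesgue B = measure lebesgue C"
    using measure_orthogonal_image[OF Q] by metis
  then have "emeasure lborel B = emeasure lborel C"
    using lm[THEN emeasure_eq_measure2] Bm Cm by simp
  then show "emeasure (distr unif_sphere borel Q) A = emeasure unif_sphere A"
    using measurable_sets_borel[OF \<open>Q \<in> borel_measurable borel\<close> A] measurable_sets_borel[OF sgn_borel A]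
      measurable_sets_borel[OF sgn_borel measurable_sets_borel[OF \<open>Q \<in> borel_measurable borel\<close> A]]
    unfolding unif_sphere_def B_def C_def
    by (simp add: emeasure_distr)
qed (simp add: unif_sphere_def)

definition r :: "nat \<Rightarrow> real^3" where
  "r i = (if i = 1 then vector [1, 1, 0]
     else if i = 2 then vector [1, -1, 0]
     else if i = 3 then vector [1, 0, 1]
     else if i = 4 then vector [1, 0, -1]
     else if i = 5 then vector [0, 1, 1]
     else if i = 6 then vector [0, 1, -1] else 0) /\<^sub>R sqrt 2"

definition verts :: "nat set" where
  "verts = {1..6}"

definition \<Gamma>\<^sub>O :: "nat set set" where
  "\<Gamma>\<^sub>O = {{i, j} | i j. i \<in> verts \<and> j \<in> verts \<and> i \<noteq> j \<and> r i \<bullet> r j \<noteq> 0}"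

definition orth_pairs :: "nat set set" where
  "orth_pairs = {{i, j} | i j. i \<in> verts \<and> j \<in> verts \<and> i \<noteq> j \<and> r i \<bullet> r j = 0}"

definition triangles :: "nat set set" where
  "triangles = {{i, j, k} | i j k. {i, j} \<in> \<Gamma>\<^sub>O \<and> {i, k} \<in> \<Gamma>\<^sub>O \<and> {j, k} \<in> \<Gamma>\<^sub>O}"

definition switching_class :: "nat \<Rightarrow> nat \<Rightarrow> nat \<Rightarrow> real" where
  "switching_class i j k = sgn ((r i \<bullet> r j) * (r i \<bullet> r k) * (r j \<bullet> r k))"

definition coplanar_triples :: "nat set set" where
  "coplanar_triples = {{i, j, k} | i j k. i \<in> verts \<and> j \<in> verts \<and> k \<in> verts \<and>
     i \<noteq> j \<and> i \<noteq> k \<and> j \<noteq> k \<and> dependent {r i, r j, r k}}"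

text \<open>Edge sets are encoded by their indicator functions with values in the two-element field,
  so that symmetric difference is pointwise addition.\<close>

global_interpretation F2: vector_space "\<lambda>(c::bit) (f :: nat set \<Rightarrow> bit) e. c * f e"
  defines F2_span = F2.span and F2_dim = F2.dim
  by unfold_locales (auto simp: fun_eq_iff algebra_simps)

definition cycle_space :: "(nat set \<Rightarrow> bit) set" where
  "cycle_space = {f. (\<forall>e. e \<notin> \<Gamma>\<^sub>O \<longrightarrow> f e = 0) \<and> (\<forall>v\<in>verts. (\<Sum>e\<in>{e\<in>\<Gamma>\<^sub>O. v \<in> e}. f e) = 0)}"

definition triangle_vec :: "nat set \<Rightarrow> nat set \<Rightarrow> bit" where
  "triangle_vec T = indicator {e. e \<subseteq> T \<and> card e = 2}"

definition seg :: "nat \<Rightarrow> (real^3) set" where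
  "seg j = closed_segment (- (r j /\<^sub>R 2)) (r j /\<^sub>R 2)"

text \<open>Sums of sets are Minkowski sums.\<close>

definition trunc_oct :: "(real^3) set" where
  "trunc_oct = (\<Sum>j\<in>verts. seg j)"

definition generates :: "nat set \<Rightarrow> (real^3) set \<Rightarrow> bool" where
  "generates J F \<longleftrightarrow> F facet_of trunc_oct \<and> (\<exists>t. F = (\<lambda>x. t + x) ` (\<Sum>j\<in>J. seg j))"

definition hexagon :: "(real^3) set \<Rightarrow> bool" where
  "hexagon F \<longleftrightarrow> polytope F \<and> aff_dim F = 2 \<and> card {v. v extreme_point_of F} = 6"

definition square :: "(real^3) set \<Rightarrow> bool" where
  "square F \<longleftrightarrow> (\<exists>p u v. u \<noteq> 0 \<and> norm u = norm v \<and> u \<bullet> v = 0 \<and>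
     F = convex hull {p, p + u, p + v, p + u + v})"

end

theory Submission
  imports Defs
begin

text \<open>For unit vectors \<open>n\<close>, \<open>m\<close> a rotation turns \<open>(u \<bullet> n) (u \<bullet> m)\<close> into
  \<open>(1 - t) x\<^sup>2 - t y\<^sup>2\<close> with \<open>t = (1 - n \<bullet> m) / 2\<close>. The mean of its absolute value is convex in
  \<open>t\<close> and symmetric about \<open>1/2\<close>, so it is strictly monotone in \<open>\<bar>n \<bullet> m\<bar>\<close> and no closed formula is
  needed. The third moments of the two kinds of triangle are compared by averaging over coordinate
  sign changes: their difference becomes the mean of
  \<open>(\<bar>x+y\<bar> - \<bar>x-y\<bar>) (\<bar>x+z\<bar> - \<bar>x-z\<bar>) (\<bar>y+z\<bar> - \<bar>y-z\<bar>)\<close>, which has the sign of \<open>(x y z)\<^sup>2\<close>. As the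
  triangles span the cycle space, the Gram matrix is then known up to switching, and families with
  equal Gram matrices differ by a product of reflections.

  The face of a zonotope in direction \<open>a\<close> is a translate of the zonotope of the generators orthogonal
  to \<open>a\<close>, so facets correspond to directions orthogonal to two independent generators.\<close>

section \<open>Moments on the sphere\<close>

text \<open>The absolute values in the moments erase individual signs, so a triple of unit vectors
  with all correlations of modulus 1/2 has only two possible third moments, one per switching class.
  The generators realise both values, and reconstruction rests on the two being different. Strict
  inequalities therefore replace explicit integration: each comes from a nonnegative continuous
  integrand that is positive at one point of the sphere, because the uniform measure charges every
  open set meeting the sphere. Passing through the Gram matrix loses nothing: families with equal
  Gram matrices are related by an orthogonal map even when they are linearly dependent, as six
  vectors in space must be. The correlation graph is the octahedron graph, its nonadjacent vertices
  being the orthogonal pairs, so a triangle takes one index from each of the three pairs. This is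
  why the third-order difference factors into three terms. On the facet side the point to secure is
  that a facet, as a bare set, determines its generators; the counts and the uniqueness of the
  opposite pair rest on this.\<close>

lemma gram_reflection:
  fixes v w :: "'a::euclidean_space"
  assumes "norm v = norm w"
  obtains f where "orthogonal_transformation f" "f v = w" "\<And>x. x \<bullet> v = x \<bullet> w \<Longrightarrow> f x = x"
proof
  define d where "d = v - w"
  \<comment> \<open>Reflection in the hyperplane orthogonal to \<open>v - w\<close>. If
    \<open>d = 0\<close>, division by zero gives 0 and \<open>f\<close> is the identity, as it
    should be when \<open>v = w\<close>.\<close>
  define f where "f = (\<lambda>x. x - (2 * (x \<bullet> d) / (d \<bullet> d)) *\<^sub>R d)"
  have vw: "v \<bullet> v = w \<bullet> w" using assms by (simp add: norm_eq)
  show "orthogonal_transformation f"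
    unfolding orthogonal_transformation_def
  proof (intro conjI allI)
    show "linear f"
      by (rule linearI) (simp_all add: f_def inner_add_left algebra_simps add_divide_distrib)
    fix x y
    show "f x \<bullet> f y = x \<bullet> y"
      by (cases "d = 0") (simp_all add: f_def inner_diff_left inner_diff_right inner_commute field_simps)
  qed
  have "2 * (v \<bullet> d) = d \<bullet> d"
    using vw by (simp add: d_def inner_diff_left inner_diff_right inner_commute)
  then show "f v = w" by (cases "d = 0") (auto simp: f_def d_def)
  show "f x = x" if "x \<bullet> v = x \<bullet> w" for x
    using that by (simp add: f_def d_def inner_diff_right)
qed

text \<open>Induction moves one vector at a time into place. Equality of inner products says that
  each \<open>w i\<close> already reached has the same product with \<open>f (v k)\<close> and with
  \<open>w k\<close>, so the reflection taking one to the other fixes it. Linear dependence causes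
  no difficulty.\<close>

lemma gram_orthogonal:
  fixes v w :: "'i \<Rightarrow> 'a::euclidean_space"
  assumes "finite I" "\<And>i j. i \<in> I \<Longrightarrow> j \<in> I \<Longrightarrow> v i \<bullet> v j = w i \<bullet> w j"
  obtains f where "orthogonal_transformation f" "\<And>i. i \<in> I \<Longrightarrow> f (v i) = w i"
proof -
  have "\<exists>f. orthogonal_transformation f \<and> (\<forall>i\<in>I. f (v i) = w i)"
    using assms
  proof (induction I rule: finite_induct)
    case empty
    then show ?case using orthogonal_transformation_id by blast
  next
    case (insert k I)
    then obtain f where f: "orthogonal_transformation f" "\<forall>i\<in>I. f (v i) = w i" by auto
    have ip: "f x \<bullet> f y = x \<bullet> y" for x y
      using f by (simp add: orthogonal_transformation_def)
    have "norm (f (v k)) = norm (w k)"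
      using insert.prems[of k k] by (simp add: norm_eq ip)
    then obtain g where g: "orthogonal_transformation g" "g (f (v k)) = w k"
      "\<And>x. x \<bullet> f (v k) = x \<bullet> w k \<Longrightarrow> g x = x"
      using gram_reflection[of "f (v k)" "w k"] by blast
    have "g (f (v i)) = w i" if "i \<in> I" for i
    proof -
      have "w i \<bullet> f (v k) = w i \<bullet> w k"
        using f(2) that insert.prems[of i k] ip[of "v i" "v k"] by simp
      then show ?thesis using g(3) f(2) that by simp
    qed
    then show ?case
      using g(1,2) f orthogonal_transformation_compose[OF g(1) f(1)]
      by (intro exI[of _ "g \<circ> f"]) (auto simp: o_def)
  qed
  then show ?thesis using that by blast
qed

section \<open>Integration against the uniform measure on the sphere\<close>

lemma space_unif_sphere [simp]: "space unif_sphere = UNIV"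
  and sets_unif_sphere [simp, measurable_cong]: "sets unif_sphere = sets borel"
  by (simp_all add: unif_sphere_def)

text \<open>The measure is concentrated on the compact unit sphere, where a continuous function is
  bounded whatever its growth elsewhere.\<close>

lemma integrable_unif_sphere:
  fixes f :: "real^3 \<Rightarrow> real"
  assumes "continuous_on UNIV f"
  shows "integrable unif_sphere f"
proof -
  interpret prob_space unif_sphere by (rule prob_space_unif_sphere)
  have "compact (f ` sphere 0 1)"
    by (intro compact_continuous_image continuous_on_subset[OF assms]) auto
  then obtain B where B: "\<And>u. u \<in> sphere 0 1 \<Longrightarrow> norm (f u) \<le> B"
    by (meson bounded_iff compact_imp_bounded imageI)
  show ?thesis
  proof (rule integrable_const_bound)
    show "AE u in unif_sphere. norm (f u) \<le> B"
      using AE_unif_sphere by eventually_elim (rule B)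
    show "f \<in> borel_measurable unif_sphere"
      using borel_measurable_continuous_onI[OF assms] by simp
  qed
qed

text \<open>The cone over \<open>A\<close> meets the punctured ball in a nonempty open set, which
  has positive volume. The origin is removed because \<open>sgn\<close> is discontinuous
  there.\<close>

lemma emeasure_unif_sphere_open:
  assumes "open A" "p \<in> A" "norm p = 1"
  shows "emeasure unif_sphere A \<noteq> 0"
proof
  define B where "B = (ball (0::real^3) 1 - {0}) \<inter> sgn -` A"
  have Am: "A \<in> sets borel" using assms(1) by simp
  have "continuous_on (ball (0::real^3) 1 - {0}) sgn"
    unfolding sgn_div_norm[abs_def] by (intro continuous_intros) auto
  then have oB: "open B"
    unfolding B_def by (intro continuous_open_preimage assms(1)) (auto intro: open_delete)
  have "p /\<^sub>R 2 \<in> B"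
    using assms by (auto simp: B_def sgn_div_norm)
  then have "\<not> negligible B" using oB open_not_negligible by blast
  moreover assume 0: "emeasure unif_sphere A = 0"
  define N where "N = ball (0::real^3) 1 \<inter> sgn -` A"
  have Nm: "N \<in> sets lborel"
    using measurable_sets_borel[OF sgn_borel Am] unfolding N_def by simp
  have N0: "emeasure lborel N = 0"
    using 0 emeasure_ball_fin measurable_sets_borel[OF sgn_borel Am]
    unfolding unif_sphere_def N_def
    by (simp add: emeasure_distr Am ennreal_divide_eq_0_iff)
  have "B \<subseteq> N" by (auto simp: B_def N_def)
  then have "emeasure lborel B = 0" using Nm N0 emeasure_eq_0 by blast
  then have "B \<in> null_sets lebesgue"
    using oB by (intro null_sets_completionI null_setsI) auto
  then have "negligible B" using negligible_iff_null_sets by blast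
  ultimately show False by simp
qed

text \<open>Turns positivity at a single point of the sphere into a strict inequality between
  moments.\<close>

lemma integral_unif_sphere_pos:
  fixes f :: "real^3 \<Rightarrow> real"
  assumes "continuous_on UNIV f" "\<And>u. 0 \<le> f u" "norm p = 1" "0 < f p"
  shows "0 < (\<integral>u. f u \<partial>unif_sphere)"
proof (rule ccontr)
  assume "\<not> 0 < (\<integral>u. f u \<partial>unif_sphere)"
  moreover have "0 \<le> (\<integral>u. f u \<partial>unif_sphere)" using assms(2) by simp
  ultimately have "(\<integral>u. f u \<partial>unif_sphere) = 0" by simp
  then have "AE u in unif_sphere. f u = 0"
    using integral_nonneg_eq_0_iff_AE[OF integrable_unif_sphere[OF assms(1)]] assms(2) by simp
  then have "AE u in unif_sphere. \<not> 0 < f u" by eventually_elim simp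
  moreover have o: "open {u. 0 < f u}"
    by (intro open_Collect_less continuous_intros assms(1))
  ultimately have "emeasure unif_sphere {u. 0 < f u} = 0"
    by (subst (asm) AE_iff_measurable[OF _ refl]) auto
  then show False
    using emeasure_unif_sphere_open[OF o, of p] assms by simp
qed

text \<open>An orthogonal map carrying \<open>v\<close> to \<open>w\<close> preserves the uniform
  measure, so moments are functions of the Gram matrix alone.\<close>

lemma I_mom_gram:
  fixes v w :: "nat \<Rightarrow> real^3"
  assumes "\<And>i j. i \<in> set js \<Longrightarrow> j \<in> set js \<Longrightarrow> v i \<bullet> v j = w i \<bullet> w j"
  shows "I_mom (map v js) = I_mom (map w js)"
proof -
  obtain f where f: "orthogonal_transformation f" "\<And>i. i \<in> set js \<Longrightarrow> f (v i) = w i"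
    using gram_orthogonal[of "set js" v w] assms by auto
  have fm [measurable]: "f \<in> borel_measurable borel"
    using f(1) by (intro borel_measurable_continuous_onI linear_continuous_on)
      (auto simp: orthogonal_transformation_def linear_conv_bounded_linear)
  have gm: "(\<lambda>u. \<Prod>j\<leftarrow>js. \<bar>u \<bullet> w j\<bar>) \<in> borel_measurable (borel :: (real^3) measure)"
    by (induction js) auto
  have "I_mom (map w js) = (\<integral>u. (\<Prod>j\<leftarrow>js. \<bar>u \<bullet> w j\<bar>) \<partial>distr unif_sphere borel f)"
    by (simp add: I_mom_def unif_sphere_orthogonal[OF f(1)] o_def)
  also have "\<dots> = (\<integral>u. (\<Prod>j\<leftarrow>js. \<bar>f u \<bullet> w j\<bar>) \<partial>unif_sphere)"
    using gm by (intro integral_distr) auto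
  also have "(\<lambda>u. \<Prod>j\<leftarrow>js. \<bar>f u \<bullet> w j\<bar>) = (\<lambda>u. \<Prod>j\<leftarrow>js. \<bar>u \<bullet> v j\<bar>)"
  proof
    fix u
    have "f u \<bullet> w j = u \<bullet> v j" if "j \<in> set js" for j
      using f(1) f(2)[OF that] by (metis orthogonal_transformation_def)
    then show "(\<Prod>j\<leftarrow>js. \<bar>f u \<bullet> w j\<bar>) = (\<Prod>j\<leftarrow>js. \<bar>u \<bullet> v j\<bar>)"
      by (intro arg_cong[of _ _ prod_list] map_cong) auto
  qed
  finally show ?thesis by (simp add: I_mom_def o_def)
qed

text \<open>For unit vectors with correlation \<open>c\<close> the vectors $n + m$ and $n - m$ are orthogonal, so after a
  rotation \<open>(u \<bullet> n) (u \<bullet> m)\<close> becomes \<open>(u\<^sub>1)\<^sup>2 - t ((u\<^sub>1)\<^sup>2 + (u\<^sub>2)\<^sup>2)\<close>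
  with \<open>t = (1 - c) / 2\<close>.\<close>

definition pair_moment :: "real \<Rightarrow> real" where
  "pair_moment t = (\<integral>u. \<bar>(u$1)\<^sup>2 - t * ((u$1)\<^sup>2 + (u$2)\<^sup>2)\<bar> \<partial>unif_sphere)"

lemma I_mom_pair:
  fixes n m :: "real^3"
  assumes "norm n = 1" "norm m = 1"
  shows "I_mom [n, m] = pair_moment ((1 - n \<bullet> m) / 2)"
proof -
  define c where "c = n \<bullet> m"
  have c: "\<bar>c\<bar> \<le> 1" using Cauchy_Schwarz_ineq2[of n m] assms by (simp add: c_def)
  \<comment> \<open>Cosine and sine of half the angle between \<open>n\<close> and \<open>m\<close>:
    the model vectors are placed symmetrically about the first axis.\<close>
  define p q where "p = sqrt ((1 + c) / 2)" and "q = sqrt ((1 - c) / 2)"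
  have pq: "p\<^sup>2 = (1 + c) / 2" "q\<^sup>2 = (1 - c) / 2" using c by (simp_all add: p_def q_def)
  define v :: "nat \<Rightarrow> real^3" where "v = (\<lambda>i. if i = 0 then vector [p, q, 0] else vector [p, -q, 0])"
  define w where "w = (\<lambda>i::nat. if i = 0 then n else m)"
  have nm: "n \<bullet> n = 1" "m \<bullet> m = 1" using assms by (simp_all add: norm_eq_1)
  have "I_mom (map w [0,1]) = I_mom (map v [0,1])"
  proof (rule I_mom_gram)
    have vv: "vector [p, a, 0] \<bullet> (vector [p, b, 0] :: real^3) = p\<^sup>2 + a * b" for a b
      by (simp add: inner_vec_def sum_3 vector_3 power2_eq_square)
    have "p\<^sup>2 + q\<^sup>2 = 1" "p\<^sup>2 - q\<^sup>2 = c" unfolding pq by (simp_all add: field_simps)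
    moreover fix i j :: nat assume "i \<in> set [0,1]" "j \<in> set [0,1]"
    ultimately show "w i \<bullet> w j = v i \<bullet> v j"
      using nm by (auto simp: w_def v_def vv c_def inner_commute[of m n] power2_eq_square)
  qed
  moreover have "\<bar>u \<bullet> v 0\<bar> * \<bar>u \<bullet> v 1\<bar> = \<bar>(u$1)\<^sup>2 - (1 - c) / 2 * ((u$1)\<^sup>2 + (u$2)\<^sup>2)\<bar>" for u
  proof -
    have "(u \<bullet> v 0) * (u \<bullet> v 1) = p\<^sup>2 * (u$1)\<^sup>2 - q\<^sup>2 * (u$2)\<^sup>2"
      by (simp add: v_def inner_vec_def sum_3 vector_3 power2_eq_square algebra_simps)
    also have "\<dots> = (u$1)\<^sup>2 - (1 - c) / 2 * ((u$1)\<^sup>2 + (u$2)\<^sup>2)"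
      unfolding pq by (simp add: field_simps)
    finally show ?thesis by (simp add: abs_mult[symmetric])
  qed
  ultimately show ?thesis by (simp add: I_mom_def pair_moment_def w_def c_def)
qed

text \<open>Replacing \<open>m\<close> by \<open>- m\<close> replaces \<open>t\<close> by
  \<open>1 - t\<close>. On the model, swapping the first two coordinates turns the expression for
  \<open>1 - t\<close> into the negative of the one for \<open>t\<close>.\<close>

lemma pair_moment_swap: "pair_moment (1 - t) = pair_moment t"
proof -
  define T :: "real^3 \<Rightarrow> real^3" where "T = (\<lambda>u. vector [u$2, u$1, u$3])"
  have T: "orthogonal_transformation T"
    unfolding orthogonal_transformation_def
    by (auto simp: T_def linear_iff vec_eq_iff forall_3 vector_3 inner_vec_def sum_3)
  have "linear T" using T by (simp add: orthogonal_transformation_def)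
  then have Tm [measurable]: "T \<in> borel_measurable borel"
    by (intro borel_measurable_continuous_onI linear_continuous_on)
      (auto simp: linear_conv_bounded_linear)
  have "pair_moment (1 - t) = (\<integral>u. \<bar>(u$1)\<^sup>2 - (1 - t) * ((u$1)\<^sup>2 + (u$2)\<^sup>2)\<bar> \<partial>distr unif_sphere borel T)"
    by (simp add: pair_moment_def unif_sphere_orthogonal[OF T])
  also have "\<dots> = (\<integral>u. \<bar>(T u$1)\<^sup>2 - (1 - t) * ((T u$1)\<^sup>2 + (T u$2)\<^sup>2)\<bar> \<partial>unif_sphere)"
    by (intro integral_distr borel_measurable_continuous_onI continuous_intros) auto
  also have "\<dots> = pair_moment t"
    unfolding pair_moment_def
    by (intro Bochner_Integration.integral_cong) (auto simp: T_def vector_3 algebra_simps abs_minus_commute)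
  finally show ?thesis .
qed

text \<open>\<open>t\<close> lies strictly between \<open>s\<close> and \<open>1 - s\<close>, where
  the moment takes equal values, so convexity bounds it by that common value.\<close>

lemma pair_moment_strict_decreasing:
  assumes "0 \<le> s" "s < t" "t \<le> 1/2"
  shows "pair_moment t < pair_moment s"
proof -
  \<comment> \<open>The weight solving \<open>t = l * s + (1 - l) * (1 - s)\<close>.\<close>
  define l where "l = (1 - s - t) / (1 - 2 * s)"
  have s: "1 - 2 * s > 0" using assms by simp
  have l: "0 < l" "l < 1" using assms s by (auto simp: l_def)
  have "l * (1 - 2 * s) = 1 - s - t" using s by (simp add: l_def)
  then have t: "t = l * s + (1 - l) * (1 - s)" by (simp add: algebra_simps)
  define g where "g = (\<lambda>(a::real) (u::real^3). (u$1)\<^sup>2 - a * ((u$1)\<^sup>2 + (u$2)\<^sup>2))"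
  have gc: "continuous_on UNIV (g a)" for a unfolding g_def by (intro continuous_intros)
  define h where "h = (\<lambda>u. l * \<bar>g s u\<bar> + (1 - l) * \<bar>g (1 - s) u\<bar> - \<bar>g t u\<bar>)"
  have gt: "g t u = l * g s u + (1 - l) * g (1 - s) u" for u
    unfolding t g_def by (simp add: algebra_simps)
  have int: "integrable unif_sphere (\<lambda>u. \<bar>g a u\<bar>)" for a
    by (intro integrable_unif_sphere continuous_intros gc)
  have "0 < (\<integral>u. h u \<partial>unif_sphere)"
  proof (rule integral_unif_sphere_pos)
    show "continuous_on UNIV h" unfolding h_def by (intro continuous_intros gc)
    show "0 \<le> h u" for u
      using l abs_triangle_ineq[of "l * g s u" "(1 - l) * g (1 - s) u"]
      by (simp add: h_def gt abs_mult)
    \<comment> \<open>On the diagonal \<open>g s\<close> and \<open>g (1 - s)\<close> have opposite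
      signs, which makes the triangle inequality strict there.\<close>
    let ?p = "vector [1 / sqrt 2, 1 / sqrt 2, 0] :: real^3"
    show "norm ?p = 1"
      by (simp add: norm_eq_1 inner_vec_def sum_3 vector_3)
    define k where "k = (1 - 2 * s) / 2"
    have gp: "g s ?p = k" "g (1 - s) ?p = - k"
      by (simp_all add: g_def k_def vector_3 power_divide field_simps)
    have "h ?p = l * k + (1 - l) * k - \<bar>l * k - (1 - l) * k\<bar>"
      using s by (simp add: h_def gt gp k_def)
    moreover have "0 < a + b - \<bar>a - b\<bar>" if "0 < a" "0 < b" for a b :: real
      using that by (simp add: abs_if)
    moreover have "0 < l * k" "0 < (1 - l) * k" using l s by (auto simp: k_def)
    ultimately show "0 < h ?p" by metis
  qed
  also have "(\<integral>u. h u \<partial>unif_sphere) = l * pair_moment s + (1 - l) * pair_moment (1 - s) - pair_moment t"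
    unfolding h_def using int by (simp add: pair_moment_def g_def)
  finally show ?thesis unfolding pair_moment_swap by (simp add: algebra_simps)
qed

lemma I_mom_pair_determines_abs_inner:
  fixes n m n' m' :: "real^3"
  assumes "norm n = 1" "norm m = 1" "norm n' = 1" "norm m' = 1"
    and "I_mom [n, m] = I_mom [n', m']"
  shows "\<bar>n \<bullet> m\<bar> = \<bar>n' \<bullet> m'\<bar>"
proof -
  \<comment> \<open>After a possible change of sign the parameter lies between 0 and 1/2, where the
    moment is strictly decreasing.\<close>
  have red: "I_mom [n, m] = pair_moment ((1 - \<bar>n \<bullet> m\<bar>) / 2)" if "norm n = 1" "norm m = 1"
    for n m :: "real^3"
  proof (cases "n \<bullet> m \<ge> 0")
    case False
    have "1 - (1 - n \<bullet> m) / 2 = (1 - \<bar>n \<bullet> m\<bar>) / 2" using False by (simp add: field_simps)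
    then show ?thesis using I_mom_pair[OF that] pair_moment_swap by metis
  qed (simp add: I_mom_pair that)
  have bd: "\<bar>n \<bullet> m\<bar> \<le> 1" "\<bar>n' \<bullet> m'\<bar> \<le> 1"
    using Cauchy_Schwarz_ineq2[of n m] Cauchy_Schwarz_ineq2[of n' m'] assms by simp_all
  show ?thesis
  proof (rule linorder_cases[of "\<bar>n \<bullet> m\<bar>" "\<bar>n' \<bullet> m'\<bar>"])
    assume "\<bar>n \<bullet> m\<bar> < \<bar>n' \<bullet> m'\<bar>"
    then show ?thesis
      using pair_moment_strict_decreasing[of "(1 - \<bar>n' \<bullet> m'\<bar>) / 2" "(1 - \<bar>n \<bullet> m\<bar>) / 2"] bd assms red
      by simp
  next
    assume "\<bar>n' \<bullet> m'\<bar> < \<bar>n \<bullet> m\<bar>"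
    then show ?thesis
      using pair_moment_strict_decreasing[of "(1 - \<bar>n \<bullet> m\<bar>) / 2" "(1 - \<bar>n' \<bullet> m'\<bar>) / 2"] bd assms red
      by simp
  qed
qed

section \<open>The octahedral graph\<close>

declare One_nat_def [simp del]

lemma verts_iff: "i \<in> verts \<longleftrightarrow> i = 1 \<or> i = 2 \<or> i = 3 \<or> i = 4 \<or> i = 5 \<or> i = 6"
  by (auto simp: verts_def)

lemma verts_eq: "verts = {1,2,3,4,5,6}"
  by (auto simp: verts_iff)

lemma inner_r:
  "u \<bullet> r 1 = (u$1 + u$2) / sqrt 2" "u \<bullet> r 2 = (u$1 - u$2) / sqrt 2"
  "u \<bullet> r 3 = (u$1 + u$3) / sqrt 2" "u \<bullet> r 4 = (u$1 - u$3) / sqrt 2"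
  "u \<bullet> r 5 = (u$2 + u$3) / sqrt 2" "u \<bullet> r 6 = (u$2 - u$3) / sqrt 2"
  by (simp_all add: r_def inner_vec_def sum_3 vector_3 divide_inverse algebra_simps)

lemma r_nth:
  "r 1 $ 1 = 1 / sqrt 2" "r 1 $ 2 = 1 / sqrt 2" "r 1 $ 3 = 0"
  "r 2 $ 1 = 1 / sqrt 2" "r 2 $ 2 = - 1 / sqrt 2" "r 2 $ 3 = 0"
  "r 3 $ 1 = 1 / sqrt 2" "r 3 $ 2 = 0" "r 3 $ 3 = 1 / sqrt 2"
  "r 4 $ 1 = 1 / sqrt 2" "r 4 $ 2 = 0" "r 4 $ 3 = - 1 / sqrt 2"
  "r 5 $ 1 = 0" "r 5 $ 2 = 1 / sqrt 2" "r 5 $ 3 = 1 / sqrt 2"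
  "r 6 $ 1 = 0" "r 6 $ 2 = 1 / sqrt 2" "r 6 $ 3 = - 1 / sqrt 2"
  by (simp_all add: r_def vector_3 divide_inverse)

lemma r_gram:
  "i \<in> verts \<Longrightarrow> r i \<bullet> r i = 1"
  "r 1 \<bullet> r 2 = 0" "r 1 \<bullet> r 3 = 1/2" "r 1 \<bullet> r 4 = 1/2" "r 1 \<bullet> r 5 = 1/2" "r 1 \<bullet> r 6 = 1/2"
  "r 2 \<bullet> r 3 = 1/2" "r 2 \<bullet> r 4 = 1/2" "r 2 \<bullet> r 5 = -1/2" "r 2 \<bullet> r 6 = -1/2"
  "r 3 \<bullet> r 4 = 0" "r 3 \<bullet> r 5 = 1/2" "r 3 \<bullet> r 6 = -1/2"
  "r 4 \<bullet> r 5 = -1/2" "r 4 \<bullet> r 6 = 1/2"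
  "r 5 \<bullet> r 6 = 0"
  by (auto simp: verts_iff inner_r r_nth)

lemma r_gram':
  "r 2 \<bullet> r 1 = 0" "r 3 \<bullet> r 1 = 1/2" "r 4 \<bullet> r 1 = 1/2" "r 5 \<bullet> r 1 = 1/2" "r 6 \<bullet> r 1 = 1/2"
  "r 3 \<bullet> r 2 = 1/2" "r 4 \<bullet> r 2 = 1/2" "r 5 \<bullet> r 2 = -1/2" "r 6 \<bullet> r 2 = -1/2"
  "r 4 \<bullet> r 3 = 0" "r 5 \<bullet> r 3 = 1/2" "r 6 \<bullet> r 3 = -1/2"
  "r 5 \<bullet> r 4 = -1/2" "r 6 \<bullet> r 4 = 1/2"
  "r 6 \<bullet> r 5 = 0"
  by (subst inner_commute, rule r_gram)+

lemma norm_r: "i \<in> verts \<Longrightarrow> norm (r i) = 1"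
  by (simp add: norm_eq_1 r_gram)

lemma r_inner_cases:
  assumes "i \<in> verts" "j \<in> verts" "i \<noteq> j"
  shows "r i \<bullet> r j = 0 \<or> r i \<bullet> r j = 1/2 \<or> r i \<bullet> r j = -1/2"
  using assms unfolding verts_iff by (elim disjE) (simp_all add: r_gram r_gram')

lemma r_inj:
  assumes "i \<in> verts" "j \<in> verts" "i \<noteq> j"
  shows "r i \<noteq> r j"
  using r_inner_cases[OF assms] r_gram(1)[OF assms(1)] by auto

lemma \<Gamma>_iff: "{i, j} \<in> \<Gamma>\<^sub>O \<longleftrightarrow> i \<in> verts \<and> j \<in> verts \<and> i \<noteq> j \<and> r i \<bullet> r j \<noteq> 0"
  unfolding \<Gamma>\<^sub>O_def by (auto simp: doubleton_eq_iff inner_commute)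

lemma orth_pairs_iff: "{i, j} \<in> orth_pairs \<longleftrightarrow> i \<in> verts \<and> j \<in> verts \<and> i \<noteq> j \<and> r i \<bullet> r j = 0"
  unfolding orth_pairs_def by (auto simp: doubleton_eq_iff inner_commute)

lemma orth_pairs_eq: "orth_pairs = {{1,2},{3,4},{5,6}}"
proof -
  have *: "{i, j} \<in> {{1,2},{3,4},{5,6}}" if "i \<in> verts" "j \<in> verts" "i \<noteq> j" "r i \<bullet> r j = 0" for i j
    using that unfolding verts_iff by (elim disjE) (simp_all add: r_gram r_gram' doubleton_eq_iff)
  have "orth_pairs \<subseteq> {{1,2},{3,4},{5,6}}" unfolding orth_pairs_def
    by (intro subsetI, elim CollectE exE conjE, hypsubst) (rule *; assumption)
  then show ?thesis by (auto simp: orth_pairs_iff verts_iff r_gram)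
qed

lemma card_orth_pairs: "card orth_pairs = 3"
  by (simp add: orth_pairs_eq doubleton_eq_iff)

lemma \<Gamma>_eq: "\<Gamma>\<^sub>O = {{1,3},{1,4},{1,5},{1,6},{2,3},{2,4},{2,5},{2,6},{3,5},{3,6},{4,5},{4,6}}" (is "_ = ?E")
proof -
  have *: "{i, j} \<in> ?E" if "i \<in> verts" "j \<in> verts" "i \<noteq> j" "r i \<bullet> r j \<noteq> 0" for i j
    using that unfolding verts_iff by (elim disjE) (simp_all add: r_gram r_gram' doubleton_eq_iff)
  have "\<Gamma>\<^sub>O \<subseteq> ?E" unfolding \<Gamma>\<^sub>O_def
    by (intro subsetI, elim CollectE exE conjE, hypsubst) (rule *; assumption)
  moreover have "?E \<subseteq> \<Gamma>\<^sub>O" by (simp add: \<Gamma>_iff verts_iff r_gram)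
  ultimately show ?thesis by blast
qed

lemma triangles_iff:
  "{i, j, k} \<in> triangles \<longleftrightarrow> {i, j} \<in> \<Gamma>\<^sub>O \<and> {i, k} \<in> \<Gamma>\<^sub>O \<and> {j, k} \<in> \<Gamma>\<^sub>O"
proof
  assume "{i, j, k} \<in> triangles"
  then obtain a b c where abc: "{i, j, k} = {a, b, c}" "{a, b} \<in> \<Gamma>\<^sub>O" "{a, c} \<in> \<Gamma>\<^sub>O" "{b, c} \<in> \<Gamma>\<^sub>O"
    unfolding triangles_def by blast
  have d: "a \<noteq> b" "a \<noteq> c" "b \<noteq> c" using abc(2-4) \<Gamma>_iff by blast+
  then have "card {i, j, k} = 3" unfolding abc(1) by simp
  then have ne: "i \<noteq> j" "i \<noteq> k" "j \<noteq> k" by (auto simp: card_insert_if split: if_splits)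
  have E: "{x, y} \<in> \<Gamma>\<^sub>O" if "x \<in> {a,b,c}" "y \<in> {a,b,c}" "x \<noteq> y" for x y
    using that abc(2-4) by (auto simp: insert_commute)
  show "{i, j} \<in> \<Gamma>\<^sub>O \<and> {i, k} \<in> \<Gamma>\<^sub>O \<and> {j, k} \<in> \<Gamma>\<^sub>O"
    using E[of i j] E[of i k] E[of j k] ne unfolding abc(1)[symmetric] by simp
qed (auto simp: triangles_def)

lemma triangles_eq:
  "triangles = {{1,3,5},{1,3,6},{1,4,5},{1,4,6},{2,3,5},{2,3,6},{2,4,5},{2,4,6}}" (is "_ = ?T")
proof -
  have *: "{i, j, k} \<in> ?T" if "{i, j} \<in> \<Gamma>\<^sub>O" "{i, k} \<in> \<Gamma>\<^sub>O" "{j, k} \<in> \<Gamma>\<^sub>O" for i j k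
  proof -
    have "i \<in> verts" "j \<in> verts" "k \<in> verts" "i \<noteq> j" "i \<noteq> k" "j \<noteq> k"
      "r i \<bullet> r j \<noteq> 0" "r i \<bullet> r k \<noteq> 0" "r j \<bullet> r k \<noteq> 0"
      using that by (auto simp: \<Gamma>_iff)
    then show ?thesis unfolding verts_iff
      by (elim disjE) (simp_all add: r_gram r_gram' set_eq_subset)
  qed
  have "triangles \<subseteq> ?T" unfolding triangles_def
    by (intro subsetI, elim CollectE exE conjE, hypsubst) (rule *; assumption)
  moreover have "?T \<subseteq> triangles" by (simp add: triangles_iff \<Gamma>_iff verts_iff r_gram)
  ultimately show ?thesis by blast
qed

lemma card_triangles: "card triangles = 8"
  by (simp add: triangles_eq set_eq_subset)

section \<open>Gram determinants and coplanar triples\<close>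

text \<open>The right-hand side is the Gram determinant. A relation among the vectors is annihilated
  by the Gram matrix, hence by its determinant; conversely a row of the adjugate supplies the
  coefficients of a relation.\<close>

lemma dependent_unit_triple:
  fixes u v w :: "'a::euclidean_space"
  assumes "norm u = 1" "norm v = 1" "norm w = 1" "(v \<bullet> w)\<^sup>2 \<noteq> 1" "u \<noteq> v" "u \<noteq> w" "v \<noteq> w"
  shows "dependent {u, v, w} \<longleftrightarrow>
    1 + 2 * (u \<bullet> v) * (u \<bullet> w) * (v \<bullet> w) - (u \<bullet> v)\<^sup>2 - (u \<bullet> w)\<^sup>2 - (v \<bullet> w)\<^sup>2 = 0"
    (is "_ \<longleftrightarrow> ?det = 0")
proof
  define p q s where pqs: "p = u \<bullet> v" "q = u \<bullet> w" "s = v \<bullet> w"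
  have g: "u \<bullet> u = 1" "v \<bullet> v = 1" "w \<bullet> w = 1" "u \<bullet> v = p" "v \<bullet> u = p" "u \<bullet> w = q" "w \<bullet> u = q"
    "v \<bullet> w = s" "w \<bullet> v = s"
    using assms(1-3) by (simp_all add: norm_eq_1 pqs inner_commute)
  have dep: "dependent {u, v, w} \<longleftrightarrow>
    (\<exists>a b c. (a \<noteq> 0 \<or> b \<noteq> 0 \<or> c \<noteq> 0) \<and> a *\<^sub>R u + b *\<^sub>R v + c *\<^sub>R w = 0)" (is "_ = ?ex")
  proof
    assume "dependent {u, v, w}"
    then show ?ex
      using assms(5-7) by (subst (asm) dependent_finite) (auto simp: add.assoc)
  next
    assume ?ex
    then obtain a b c where abc: "a \<noteq> 0 \<or> b \<noteq> 0 \<or> c \<noteq> 0" "a *\<^sub>R u + b *\<^sub>R v + c *\<^sub>R w = 0" by blast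
    have "(\<Sum>x\<in>{u,v,w}. (if x = u then a else if x = v then b else c) *\<^sub>R x) = 0"
      using assms(5-7) abc(2) by (auto simp: add.assoc)
    then show "dependent {u, v, w}"
      using assms(5-7) abc(1)
      by (subst dependent_finite)
        (auto intro!: exI[of _ "\<lambda>x. if x = u then a else if x = v then b else c"])
  qed
  show "?det = 0" if d: "dependent {u, v, w}"
  proof -
    obtain a b c where abc: "a \<noteq> 0 \<or> b \<noteq> 0 \<or> c \<noteq> 0" "a *\<^sub>R u + b *\<^sub>R v + c *\<^sub>R w = 0"
      using d dep by blast
    have "(a *\<^sub>R u + b *\<^sub>R v + c *\<^sub>R w) \<bullet> x = 0" for x using abc(2) by simp
    from this[of u] this[of v] this[of w]
    have e: "a + b * p + c * q = 0" "a * p + b + c * s = 0" "a * q + b * s + c = 0"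
      by (simp_all add: inner_add_left g)
    let ?D = "1 + 2 * p * q * s - p\<^sup>2 - q\<^sup>2 - s\<^sup>2"
    \<comment> \<open>The multipliers are the rows of the adjugate of the Gram matrix.\<close>
    have "a * ?D = (1 - s\<^sup>2) * (a + b * p + c * q) + (q * s - p) * (a * p + b + c * s)
        + (p * s - q) * (a * q + b * s + c)"
      "b * ?D = (q * s - p) * (a + b * p + c * q) + (1 - q\<^sup>2) * (a * p + b + c * s)
        + (p * q - s) * (a * q + b * s + c)"
      "c * ?D = (p * s - q) * (a + b * p + c * q) + (p * q - s) * (a * p + b + c * s)
        + (1 - p\<^sup>2) * (a * q + b * s + c)"
      by (simp_all add: power2_eq_square algebra_simps)
    then have "a * ?D = 0" "b * ?D = 0" "c * ?D = 0" unfolding e by simp_all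
    then show ?thesis using abc(1) by (auto simp: g)
  qed
  show "dependent {u, v, w}" if d: "?det = 0"
  proof -
    \<comment> \<open>The coefficients are the cofactors of the first row, so \<open>?x\<close> is
      orthogonal to \<open>v\<close> and \<open>w\<close>, and its product with \<open>u\<close> is
      the determinant. If that vanishes, \<open>?x\<close> is orthogonal to itself. The coefficient
      of \<open>u\<close> is nonzero because \<open>v\<close> and \<open>w\<close> are not
      parallel.\<close>
    let ?x = "(1 - s\<^sup>2) *\<^sub>R u + (q * s - p) *\<^sub>R v + (p * s - q) *\<^sub>R w"
    have "?x \<bullet> u = 1 + 2 * p * q * s - p\<^sup>2 - q\<^sup>2 - s\<^sup>2" "?x \<bullet> v = 0" "?x \<bullet> w = 0"
      by (simp_all add: inner_add_left g power2_eq_square algebra_simps)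
    then have "?x \<bullet> u = 0" "?x \<bullet> v = 0" "?x \<bullet> w = 0" using d by (simp_all add: g)
    then have "?x \<bullet> ?x = 0" by (simp only: inner_add_right inner_scaleR_right)
    then have "?x = 0" by simp
    moreover have "1 - s\<^sup>2 \<noteq> 0" using assms(4) by (simp add: pqs)
    ultimately show ?thesis using dep by blast
  qed
qed

text \<open>If no entry is zero, the determinant is \<open>1/4 + 2 * p * q * s\<close> with the
  product equal to 1/8 or -1/8, so it vanishes exactly for the negative sign. A zero entry leaves at
  least 1/2.\<close>

lemma half_gram_det:
  fixes p q s :: real
  assumes "p = 0 \<or> p = 1/2 \<or> p = -1/2" "q = 0 \<or> q = 1/2 \<or> q = -1/2" "s = 0 \<or> s = 1/2 \<or> s = -1/2"
  shows "1 + 2 * p * q * s - p\<^sup>2 - q\<^sup>2 - s\<^sup>2 = 0 \<longleftrightarrow> sgn (p * q * s) < 0"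
    and "s\<^sup>2 \<noteq> 1"
proof -
  show "1 + 2 * p * q * s - p\<^sup>2 - q\<^sup>2 - s\<^sup>2 = 0 \<longleftrightarrow> sgn (p * q * s) < 0"
    using assms by (elim disjE; hypsubst; simp add: power2_eq_square)
  show "s\<^sup>2 \<noteq> 1"
    using assms(3) by (elim disjE; hypsubst; simp add: power2_eq_square)
qed

lemma dependent_r_iff:
  assumes "i \<in> verts" "j \<in> verts" "k \<in> verts" "i \<noteq> j" "i \<noteq> k" "j \<noteq> k"
  shows "dependent {r i, r j, r k} \<longleftrightarrow> switching_class i j k < 0"
proof -
  note c = r_inner_cases[OF assms(1,2,4)] r_inner_cases[OF assms(1,3,5)] r_inner_cases[OF assms(2,3,6)]
  show ?thesis
    using assms half_gram_det(2)[OF c] half_gram_det(1)[OF c] unfolding switching_class_def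
    by (subst dependent_unit_triple) (auto simp: norm_r r_inj)
qed

text \<open>An orthogonal pair makes the switching class 0, so a dependent triple is automatically a
  triangle.\<close>

lemma coplanar_triples_switching:
  "coplanar_triples = {{i, j, k} | i j k. {i, j, k} \<in> triangles \<and> switching_class i j k < 0}"
proof -
  have "(i \<in> verts \<and> j \<in> verts \<and> k \<in> verts \<and> i \<noteq> j \<and> i \<noteq> k \<and> j \<noteq> k \<and> dependent {r i, r j, r k}) \<longleftrightarrow>
    {i, j, k} \<in> triangles \<and> switching_class i j k < 0" for i j k
    using dependent_r_iff[of i j k]
    by (auto simp: triangles_iff \<Gamma>_iff switching_class_def)
  then show ?thesis unfolding coplanar_triples_def by simp
qed

lemma coplanar_triples_eq: "coplanar_triples = {{1,3,6},{1,4,5},{2,3,5},{2,4,6}}" (is "_ = ?C")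
proof -
  have *: "{i, j, k} \<in> ?C" if "i \<in> verts" "j \<in> verts" "k \<in> verts" "i \<noteq> j" "i \<noteq> k" "j \<noteq> k"
    "dependent {r i, r j, r k}" for i j k
  proof -
    have "switching_class i j k < 0" using that dependent_r_iff by blast
    then have "(r i \<bullet> r j) * (r i \<bullet> r k) * (r j \<bullet> r k) < 0" by (simp add: switching_class_def)
    with that(1-6) show ?thesis unfolding verts_iff
      by (elim disjE) (simp_all add: r_gram r_gram' set_eq_subset)
  qed
  have "coplanar_triples \<subseteq> ?C" unfolding coplanar_triples_def
    by (intro subsetI, elim CollectE exE conjE, hypsubst) (rule *; assumption)
  moreover have "{i, j, k} \<in> coplanar_triples"
    if "i \<in> verts" "j \<in> verts" "k \<in> verts" "i \<noteq> j" "i \<noteq> k" "j \<noteq> k"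
      "(r i \<bullet> r j) * (r i \<bullet> r k) * (r j \<bullet> r k) < 0" for i j k
    using that dependent_r_iff[of i j k] unfolding coplanar_triples_def switching_class_def
    by (auto simp: sgn_less)
  then have "?C \<subseteq> coplanar_triples" by (simp add: verts_iff r_gram)
  ultimately show ?thesis by blast
qed

lemma card_coplanar_triples: "card coplanar_triples = 4"
  by (simp add: coplanar_triples_eq set_eq_subset)

section \<open>Switching classes from third moments\<close>

text \<open>Changing the signs of \<open>b'\<close> and \<open>c'\<close> does not affect the moment
  and can match both correlations at \<open>a\<close>. Equality of the products then forces the
  third correlation to match, and the Gram matrices agree.\<close>

lemma I_mom_triple_switch:
  fixes a b c a' b' c' :: "real^3"
  assumes "norm a = 1" "norm b = 1" "norm c = 1" "norm a' = 1" "norm b' = 1" "norm c' = 1"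
    and ab: "\<bar>a \<bullet> b\<bar> = \<bar>a' \<bullet> b'\<bar>" and ac: "\<bar>a \<bullet> c\<bar> = \<bar>a' \<bullet> c'\<bar>" and bc: "\<bar>b \<bullet> c\<bar> = \<bar>b' \<bullet> c'\<bar>"
    and prod: "(a \<bullet> b) * (a \<bullet> c) * (b \<bullet> c) = (a' \<bullet> b') * (a' \<bullet> c') * (b' \<bullet> c')"
    and nz: "a \<bullet> b \<noteq> 0" "a \<bullet> c \<noteq> 0"
  shows "I_mom [a, b, c] = I_mom [a', b', c']"
proof -
  define \<beta> where "\<beta> = (a \<bullet> b) / (a' \<bullet> b')"
  define \<gamma> where "\<gamma> = (a \<bullet> c) / (a' \<bullet> c')"
  have nz': "a' \<bullet> b' \<noteq> 0" "a' \<bullet> c' \<noteq> 0" using nz ab ac by auto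
  have abs1: "\<bar>\<beta>\<bar> = 1" "\<bar>\<gamma>\<bar> = 1" using ab ac nz' by (simp_all add: \<beta>_def \<gamma>_def)
  have sq: "\<beta> * \<beta> = 1" "\<gamma> * \<gamma> = 1" using abs1 by (metis abs_mult_self_eq mult_1)+
  have g: "a \<bullet> b = \<beta> * (a' \<bullet> b')" "a \<bullet> c = \<gamma> * (a' \<bullet> c')"
    using nz' by (simp_all add: \<beta>_def \<gamma>_def)
  have "(a' \<bullet> b') * (a' \<bullet> c') * (\<beta> * \<gamma> * (b \<bullet> c) - b' \<bullet> c') = 0"
    using prod unfolding g by (simp add: algebra_simps)
  then have "\<beta> * \<gamma> * (b \<bullet> c) = b' \<bullet> c'" using nz' by simp
  then have g3: "b \<bullet> c = \<beta> * \<gamma> * (b' \<bullet> c')"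
    using sq by (metis (no_types, lifting) mult.assoc mult.commute mult_1)
  define v where "v = (\<lambda>i::nat. if i = 0 then a else if i = 1 then b else c)"
  define w where "w = (\<lambda>i::nat. if i = 0 then a' else if i = 1 then \<beta> *\<^sub>R b' else \<gamma> *\<^sub>R c')"
  have unit: "a \<bullet> a = 1" "b \<bullet> b = 1" "c \<bullet> c = 1" "a' \<bullet> a' = 1" "b' \<bullet> b' = 1" "c' \<bullet> c' = 1"
    using assms(1-6) by (simp_all add: norm_eq_1)
  have "I_mom (map v [0,1,2]) = I_mom (map w [0,1,2])"
    using unit g g3 sq
    by (intro I_mom_gram) (auto simp: v_def w_def inner_commute mult.assoc)
  moreover have "\<bar>u \<bullet> (\<beta> *\<^sub>R b')\<bar> = \<bar>u \<bullet> b'\<bar>" "\<bar>u \<bullet> (\<gamma> *\<^sub>R c')\<bar> = \<bar>u \<bullet> c'\<bar>" for u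
    by (simp_all add: abs_mult abs1)
  then have "I_mom (map w [0,1,2]) = I_mom [a', b', c']"
    by (simp add: I_mom_def w_def)
  ultimately show ?thesis by (simp add: v_def)
qed

text \<open>Equals twice the smaller of the two absolute values, with the sign of
  \<open>x * y\<close>.\<close>

definition sign_gap :: "real \<Rightarrow> real \<Rightarrow> real" where
  "sign_gap x y = \<bar>x + y\<bar> - \<bar>x - y\<bar>"

lemma sgn_sign_gap: "sgn (sign_gap x y) = sgn x * sgn y"
  by (simp add: sign_gap_def sgn_if abs_if)

text \<open>Each variable enters two of the three factors, so the sign of the product is a
  square.\<close>

lemma sign_gap_prod_nonneg: "0 \<le> sign_gap x y * sign_gap x z * sign_gap y z"
proof -
  have "sgn (sign_gap x y * sign_gap x z * sign_gap y z) = (sgn x * sgn y * sgn z)\<^sup>2"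
    by (simp add: sgn_mult sgn_sign_gap power2_eq_square)
  also have "\<dots> \<ge> 0" by simp
  finally show ?thesis by (simp only: zero_le_sgn_iff)
qed

text \<open>Averaging over the sign changes of the coordinates replaces each of the two expectations by
  the mean of the four triangles of the same switching class. The two symmetrized integrands differ
  by a product of sign gaps.\<close>

lemma I_mom_switching_class_less: "I_mom [r 1, r 3, r 6] < I_mom [r 1, r 3, r 5]"
proof -
  define m where "m = (\<lambda>i j k (u::real^3). \<bar>u \<bullet> r i\<bar> * \<bar>u \<bullet> r j\<bar> * \<bar>u \<bullet> r k\<bar>)"
  have mc: "continuous_on UNIV (m i j k)" for i j k unfolding m_def by (intro continuous_intros)
  note int = integrable_unif_sphere[OF mc]
  have mI: "(\<integral>u. m i j k u \<partial>unif_sphere) = I_mom [r i, r j, r k]" for i j k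
    by (simp add: m_def I_mom_def mult.assoc)
  \<comment> \<open>Each triangle takes one index from each orthogonal pair, so these eight terms
    expand a product of three differences. A term counts positively when it contains an even number
    of the indices 2, 4, 6, which is the positive switching class.\<close>
  define h where "h = (\<lambda>u. (m 1 3 5 u + m 2 4 5 u + m 2 3 6 u + m 1 4 6 u)
    - (m 2 4 6 u + m 1 3 6 u + m 2 3 5 u + m 1 4 5 u))"
  have hg: "h u = sign_gap (u$1) (u$2) * sign_gap (u$1) (u$3) * sign_gap (u$2) (u$3) / (2 * sqrt 2)" for u
  proof -
    have "\<bar>a / sqrt 2\<bar> * \<bar>b / sqrt 2\<bar> * \<bar>c / sqrt 2\<bar> = \<bar>a\<bar> * \<bar>b\<bar> * \<bar>c\<bar> / (2 * sqrt 2)" for a b c :: real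
      by (simp add: abs_divide)
    then show ?thesis
      unfolding h_def m_def sign_gap_def inner_r
      by (simp only: add_divide_distrib[symmetric] diff_divide_distrib[symmetric]) (simp add: algebra_simps)
  qed
  have "0 < (\<integral>u. h u \<partial>unif_sphere)"
  proof (rule integral_unif_sphere_pos)
    show "continuous_on UNIV h" unfolding h_def by (intro continuous_intros mc)
    show "0 \<le> h u" for u using sign_gap_prod_nonneg by (simp add: hg)
    \<comment> \<open>All three sign gaps are positive at a point with equal positive
      coordinates.\<close>
    let ?p = "vector [1 / sqrt 3, 1 / sqrt 3, 1 / sqrt 3] :: real^3"
    show "norm ?p = 1" by (simp add: norm_eq_1 inner_vec_def sum_3 vector_3)
    show "0 < h ?p" by (simp add: hg vector_3 sign_gap_def)
  qed
  also have "(\<integral>u. h u \<partial>unif_sphere) =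
    (I_mom [r 1, r 3, r 5] + I_mom [r 2, r 4, r 5] + I_mom [r 2, r 3, r 6] + I_mom [r 1, r 4, r 6])
    - (I_mom [r 2, r 4, r 6] + I_mom [r 1, r 3, r 6] + I_mom [r 2, r 3, r 5] + I_mom [r 1, r 4, r 5])"
    unfolding h_def using int by (simp add: mI)
  also have "I_mom [r 2, r 4, r 5] = I_mom [r 1, r 3, r 5]"
    by (rule I_mom_triple_switch) (simp_all add: norm_r verts_iff r_gram)
  also have "I_mom [r 2, r 3, r 6] = I_mom [r 1, r 3, r 5]"
    by (rule I_mom_triple_switch) (simp_all add: norm_r verts_iff r_gram)
  also have "I_mom [r 1, r 4, r 6] = I_mom [r 1, r 3, r 5]"
    by (rule I_mom_triple_switch) (simp_all add: norm_r verts_iff r_gram)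
  also have "I_mom [r 2, r 4, r 6] = I_mom [r 1, r 3, r 6]"
    by (rule I_mom_triple_switch) (simp_all add: norm_r verts_iff r_gram)
  also have "I_mom [r 2, r 3, r 5] = I_mom [r 1, r 3, r 6]"
    by (rule I_mom_triple_switch) (simp_all add: norm_r verts_iff r_gram)
  also have "I_mom [r 1, r 4, r 5] = I_mom [r 1, r 3, r 6]"
    by (rule I_mom_triple_switch) (simp_all add: norm_r verts_iff r_gram)
  finally show ?thesis by simp
qed

text \<open>The triangles 135 and 136 serve as references for the two signs. Since their moments
  differ, the moment of such a triple reveals its sign.\<close>

lemma I_mom_triple_half:
  fixes a b c :: "real^3"
  assumes "norm a = 1" "norm b = 1" "norm c = 1"
    and h: "\<bar>a \<bullet> b\<bar> = 1/2" "\<bar>a \<bullet> c\<bar> = 1/2" "\<bar>b \<bullet> c\<bar> = 1/2"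
  shows "(a \<bullet> b) * (a \<bullet> c) * (b \<bullet> c) = 1/8 \<and> I_mom [a, b, c] = I_mom [r 1, r 3, r 5] \<or>
    (a \<bullet> b) * (a \<bullet> c) * (b \<bullet> c) = -1/8 \<and> I_mom [a, b, c] = I_mom [r 1, r 3, r 6]"
proof -
  have nz: "a \<bullet> b \<noteq> 0" "a \<bullet> c \<noteq> 0" using h by auto
  have "\<bar>(a \<bullet> b) * (a \<bullet> c) * (b \<bullet> c)\<bar> = 1/8" unfolding abs_mult h by simp
  then consider "(a \<bullet> b) * (a \<bullet> c) * (b \<bullet> c) = 1/8" | "(a \<bullet> b) * (a \<bullet> c) * (b \<bullet> c) = -1/8"
    by linarith
  then show ?thesis
  proof cases
    case 1
    then have "I_mom [a, b, c] = I_mom [r 1, r 3, r 5]"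
      using assms nz by (intro I_mom_triple_switch) (simp_all add: norm_r verts_iff r_gram)
    with 1 show ?thesis by blast
  next
    case 2
    then have "I_mom [a, b, c] = I_mom [r 1, r 3, r 6]"
      using assms nz by (intro I_mom_triple_switch) (simp_all add: norm_r verts_iff r_gram)
    with 2 show ?thesis by blast
  qed
qed

section \<open>Recovering a family from its moments\<close>

lemma abs_inner_r:
  assumes "i \<in> verts" "j \<in> verts" "i \<noteq> j"
  shows "\<bar>r i \<bullet> r j\<bar> = (if {i, j} \<in> orth_pairs then 0 else 1/2)"
  using r_inner_cases[OF assms] assms by (auto simp: orth_pairs_iff)

context
  fixes s :: "nat \<Rightarrow> real^3"
  assumes unit: "\<forall>i\<in>verts. norm (s i) = 1"
    and pair: "\<forall>i\<in>verts. \<forall>j\<in>verts. i < j \<longrightarrow> I_mom [s i, s j] = I_mom [r i, r j]"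
begin

lemma pair_data_abs_inner:
  assumes "i \<in> verts" "j \<in> verts" "i \<noteq> j"
  shows "\<bar>s i \<bullet> s j\<bar> = (if {i, j} \<in> orth_pairs then 0 else 1/2)"
proof -
  have lt: "\<bar>s i \<bullet> s j\<bar> = (if {i, j} \<in> orth_pairs then 0 else 1/2)"
    if "i \<in> verts" "j \<in> verts" "i < j" for i j
  proof -
    have "\<bar>s i \<bullet> s j\<bar> = \<bar>r i \<bullet> r j\<bar>"
      using that unit pair norm_r by (intro I_mom_pair_determines_abs_inner) auto
    then show ?thesis using that abs_inner_r by simp
  qed
  show ?thesis
  proof (cases "i < j")
    case False
    then have "j < i" using assms by simp
    from lt[OF assms(2,1) this] show ?thesis by (simp add: inner_commute insert_commute)
  qed (use lt assms in blast)
qed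

lemma triple_data_triangle_sign:
  assumes triple: "I_mom [s i, s j, s k] = I_mom [r i, r j, r k]"
    and tri: "{i, j, k} \<in> triangles"
  shows "(s i \<bullet> s j) * (s i \<bullet> s k) * (s j \<bullet> s k) = (r i \<bullet> r j) * (r i \<bullet> r k) * (r j \<bullet> r k)"
proof -
  have v: "i \<in> verts" "j \<in> verts" "k \<in> verts" "i \<noteq> j" "i \<noteq> k" "j \<noteq> k"
    "{i, j} \<notin> orth_pairs" "{i, k} \<notin> orth_pairs" "{j, k} \<notin> orth_pairs"
    using tri by (auto simp: triangles_iff \<Gamma>_iff orth_pairs_iff)
  have "\<bar>s i \<bullet> s j\<bar> = 1/2" "\<bar>s i \<bullet> s k\<bar> = 1/2" "\<bar>s j \<bullet> s k\<bar> = 1/2"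
    "\<bar>r i \<bullet> r j\<bar> = 1/2" "\<bar>r i \<bullet> r k\<bar> = 1/2" "\<bar>r j \<bullet> r k\<bar> = 1/2"
    using v pair_data_abs_inner abs_inner_r by simp_all
  then show ?thesis
    using I_mom_triple_half[of "s i" "s j" "s k"] I_mom_triple_half[of "r i" "r j" "r k"]
      v unit norm_r triple I_mom_switching_class_less by (metis less_irrefl)
qed

text \<open>The signs \<open>\<epsilon>\<close> are normalised along the star of vertex 1 and the edge 23; every other edge
  closes a chain of triangles, which fixes its sign.\<close>

lemma triple_data_determine:
  assumes triple: "\<forall>i\<in>verts. \<forall>j\<in>verts. \<forall>k\<in>verts. i < j \<longrightarrow> j < k \<longrightarrow>
      I_mom [s i, s j, s k] = I_mom [r i, r j, r k]"
  shows "\<exists>(\<epsilon> :: nat \<Rightarrow> real) (Q :: real^3^3). orthogonal_matrix Q \<and>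
      (\<forall>i\<in>verts. \<epsilon> i \<in> {1, -1} \<and> s i = \<epsilon> i *\<^sub>R (Q *v r i))"
proof -
  \<comment> \<open>The sign by which \<open>s\<close> and \<open>r\<close> differ on an edge. On an
    orthogonal pair the quotient would be 0 / 0, that is 0; the value 1 keeps
    \<open>\<sigma>\<close> a sign on all pairs.\<close>
  define \<sigma> where "\<sigma> = (\<lambda>i j. if {i, j} \<in> orth_pairs then 1 else (s i \<bullet> s j) / (r i \<bullet> r j))"
  have \<sigma>1: "\<sigma> i j = 1 \<or> \<sigma> i j = -1" if "i \<in> verts" "j \<in> verts" "i \<noteq> j" for i j
  proof -
    have "\<bar>\<sigma> i j\<bar> = 1"
      using pair_data_abs_inner[OF that] abs_inner_r[OF that] by (auto simp: \<sigma>_def abs_divide)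
    then show ?thesis by arith
  qed
  have \<sigma>s: "s i \<bullet> s j = \<sigma> i j * (r i \<bullet> r j)" if "i \<in> verts" "j \<in> verts" "i \<noteq> j" for i j
    using pair_data_abs_inner[OF that] abs_inner_r[OF that] by (auto simp: \<sigma>_def)
  have \<sigma>t: "\<sigma> i j * \<sigma> i k * \<sigma> j k = 1" if "i < j" "j < k" "{i, j, k} \<in> triangles" for i j k
  proof -
    have v: "i \<in> verts" "j \<in> verts" "k \<in> verts" "i \<noteq> j" "i \<noteq> k" "j \<noteq> k"
      "r i \<bullet> r j \<noteq> 0" "r i \<bullet> r k \<noteq> 0" "r j \<bullet> r k \<noteq> 0"
      using that by (auto simp: triangles_iff \<Gamma>_iff)
    have "(s i \<bullet> s j) * (s i \<bullet> s k) * (s j \<bullet> s k) = (r i \<bullet> r j) * (r i \<bullet> r k) * (r j \<bullet> r k)"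
      using triple v that by (intro triple_data_triangle_sign) auto
    then show ?thesis using v \<sigma>s by (simp add: field_simps)
  qed
  \<comment> \<open>Vertices 1 and 2 are not adjacent, so the sign of 2 is transported along the
    path 1, 3, 2.\<close>
  define \<epsilon> where "\<epsilon> = (\<lambda>i::nat. if i = 1 then 1 else if i = 2 then \<sigma> 1 3 * \<sigma> 2 3 else \<sigma> 1 i)"
  have \<epsilon>1: "\<epsilon> i = 1 \<or> \<epsilon> i = -1" if "i \<in> verts" for i
    using \<sigma>1[of 1 i] \<sigma>1[of 1 3] \<sigma>1[of 2 3] that by (auto simp: \<epsilon>_def verts_iff)
  have V: "1 \<in> verts" "2 \<in> verts" "3 \<in> verts" "4 \<in> verts" "5 \<in> verts" "6 \<in> verts"
    by (auto simp: verts_iff)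
  have T: "\<sigma> 1 3 * \<sigma> 1 5 * \<sigma> 3 5 = 1" "\<sigma> 1 3 * \<sigma> 1 6 * \<sigma> 3 6 = 1" "\<sigma> 1 4 * \<sigma> 1 5 * \<sigma> 4 5 = 1"
    "\<sigma> 1 4 * \<sigma> 1 6 * \<sigma> 4 6 = 1" "\<sigma> 2 3 * \<sigma> 2 5 * \<sigma> 3 5 = 1" "\<sigma> 2 3 * \<sigma> 2 6 * \<sigma> 3 6 = 1"
    "\<sigma> 2 4 * \<sigma> 2 5 * \<sigma> 4 5 = 1" "\<sigma> 2 4 * \<sigma> 2 6 * \<sigma> 4 6 = 1"
    by (rule \<sigma>t; simp add: triangles_eq set_eq_subset)+
  note S = \<sigma>1[OF V(1) V(3)] \<sigma>1[OF V(1) V(4)] \<sigma>1[OF V(1) V(5)] \<sigma>1[OF V(1) V(6)]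
    \<sigma>1[OF V(2) V(3)] \<sigma>1[OF V(2) V(4)] \<sigma>1[OF V(2) V(5)] \<sigma>1[OF V(2) V(6)]
    \<sigma>1[OF V(3) V(5)] \<sigma>1[OF V(3) V(6)] \<sigma>1[OF V(4) V(5)] \<sigma>1[OF V(4) V(6)]
  have sq: "x * x = 1" if "x = 1 \<or> x = -1" for x :: real using that by auto
  have sgn_eq: "z = x * y" if "x = 1 \<or> x = -1" "y = 1 \<or> y = -1" "x * y * z = 1" for x y z :: real
    using that by auto
  have E: "\<sigma> 3 5 = \<epsilon> 3 * \<epsilon> 5" "\<sigma> 3 6 = \<epsilon> 3 * \<epsilon> 6" "\<sigma> 4 5 = \<epsilon> 4 * \<epsilon> 5" "\<sigma> 4 6 = \<epsilon> 4 * \<epsilon> 6"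
    using sgn_eq[OF S(1) S(3) T(1)] sgn_eq[OF S(1) S(4) T(2)] sgn_eq[OF S(2) S(3) T(3)]
      sgn_eq[OF S(2) S(4) T(4)] by (simp_all add: \<epsilon>_def)
  have E2: "\<sigma> 2 3 = \<epsilon> 2 * \<epsilon> 3" using S(1) by (auto simp: \<epsilon>_def)
  have E3: "\<sigma> 2 5 = \<epsilon> 2 * \<epsilon> 5" "\<sigma> 2 6 = \<epsilon> 2 * \<epsilon> 6"
    using sgn_eq[OF S(5) S(9), of "\<sigma> 2 5"] sgn_eq[OF S(5) S(10), of "\<sigma> 2 6"] T(5,6) E(1,2)
    by (simp_all add: \<epsilon>_def ac_simps)
  \<comment> \<open>The edges 25 and 45 of triangle 245 are already expressed through
    \<open>\<epsilon>\<close>; vertex 5 enters twice and cancels.\<close>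
  have E4: "\<sigma> 2 4 = \<epsilon> 2 * \<epsilon> 4"
  proof -
    have "\<epsilon> 2 * \<epsilon> 4 * \<sigma> 2 4 * (\<epsilon> 5 * \<epsilon> 5) = 1"
      using T(7) unfolding E(3) E3(1) by (simp only: ac_simps)
    then show ?thesis using sgn_eq[OF \<epsilon>1[OF V(2)] \<epsilon>1[OF V(4)]] sq[OF \<epsilon>1[OF V(5)]] by simp
  qed
  have E1: "\<sigma> 1 i = \<epsilon> 1 * \<epsilon> i" if "i \<in> {3,4,5,6}" for i using that by (auto simp: \<epsilon>_def)
  have lt: "s i \<bullet> s j = \<epsilon> i * \<epsilon> j * (r i \<bullet> r j)" if "i \<in> verts" "j \<in> verts" "i < j" for i j
  proof (cases "{i, j} \<in> orth_pairs")
    case True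
    then show ?thesis using \<sigma>s[of i j] that by (simp add: orth_pairs_iff)
  next
    case False
    then have "\<sigma> i j = \<epsilon> i * \<epsilon> j"
      using that E E1 E2 E3 E4 unfolding verts_iff orth_pairs_eq by (elim disjE) simp_all
    then show ?thesis using \<sigma>s[of i j] that by simp
  qed
  have gram: "r i \<bullet> r j = (\<epsilon> i *\<^sub>R s i) \<bullet> (\<epsilon> j *\<^sub>R s j)" if "i \<in> verts" "j \<in> verts" for i j
  proof (rule linorder_cases[of i j])
    assume "i = j"
    then show ?thesis
      using that unit sq[OF \<epsilon>1[of j]] by (simp add: r_gram(1) norm_eq_1)
  next
    assume "i < j"
    then show ?thesis
      using lt[of i j] that \<epsilon>1[of i] \<epsilon>1[of j] by auto
  next
    assume "j < i"
    then show ?thesis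
      using lt[of j i] that \<epsilon>1[of i] \<epsilon>1[of j] by (auto simp: inner_commute)
  qed
  obtain f where f: "orthogonal_transformation f" "\<And>i. i \<in> verts \<Longrightarrow> f (r i) = \<epsilon> i *\<^sub>R s i"
    using gram_orthogonal[of verts r "\<lambda>i. \<epsilon> i *\<^sub>R s i"] gram by (auto simp: verts_def)
  have "orthogonal_matrix (matrix f)" "\<And>x. matrix f *v x = f x"
    using f(1) by (auto simp: orthogonal_transformation_matrix matrix_works)
  moreover have "s i = \<epsilon> i *\<^sub>R f (r i)" if "i \<in> verts" for i
    using f(2)[OF that] sq[OF \<epsilon>1[OF that]] by simp
  ultimately show ?thesis using \<epsilon>1 by (intro exI[of _ \<epsilon>] exI[of _ "matrix f"]) auto
qed

end

section \<open>The cycle space\<close>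

declare add_bit_eq_xor [simp del] mult_bit_eq_and [simp del]

lemma Collect_insert_conj:
  "{e \<in> insert x A. P e} = (if P x then insert x {e\<in>A. P e} else {e\<in>A. P e})"
  by auto

lemma edges_at:
  "{e\<in>\<Gamma>\<^sub>O. 1 \<in> e} = {{1,3},{1,4},{1,5},{1,6}}" "{e\<in>\<Gamma>\<^sub>O. 2 \<in> e} = {{2,3},{2,4},{2,5},{2,6}}"
  "{e\<in>\<Gamma>\<^sub>O. 3 \<in> e} = {{1,3},{2,3},{3,5},{3,6}}" "{e\<in>\<Gamma>\<^sub>O. 4 \<in> e} = {{1,4},{2,4},{4,5},{4,6}}"
  "{e\<in>\<Gamma>\<^sub>O. 5 \<in> e} = {{1,5},{2,5},{3,5},{4,5}}" "{e\<in>\<Gamma>\<^sub>O. 6 \<in> e} = {{1,6},{2,6},{3,6},{4,6}}"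
  unfolding \<Gamma>_eq by (simp_all only: Collect_insert_conj) simp_all

lemma sum_edges_at:
  fixes f :: "nat set \<Rightarrow> bit"
  shows "(\<Sum>e\<in>{e\<in>\<Gamma>\<^sub>O. 1 \<in> e}. f e) = f {1,3} + f {1,4} + f {1,5} + f {1,6}"
    "(\<Sum>e\<in>{e\<in>\<Gamma>\<^sub>O. 2 \<in> e}. f e) = f {2,3} + f {2,4} + f {2,5} + f {2,6}"
    "(\<Sum>e\<in>{e\<in>\<Gamma>\<^sub>O. 3 \<in> e}. f e) = f {1,3} + f {2,3} + f {3,5} + f {3,6}"
    "(\<Sum>e\<in>{e\<in>\<Gamma>\<^sub>O. 4 \<in> e}. f e) = f {1,4} + f {2,4} + f {4,5} + f {4,6}"
    "(\<Sum>e\<in>{e\<in>\<Gamma>\<^sub>O. 5 \<in> e}. f e) = f {1,5} + f {2,5} + f {3,5} + f {4,5}"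
    "(\<Sum>e\<in>{e\<in>\<Gamma>\<^sub>O. 6 \<in> e}. f e) = f {1,6} + f {2,6} + f {3,6} + f {4,6}"
  unfolding edges_at by (simp_all add: doubleton_eq_iff add.assoc)

lemma cycle_space_iff:
  "f \<in> cycle_space \<longleftrightarrow> (\<forall>e. e \<notin> \<Gamma>\<^sub>O \<longrightarrow> f e = 0) \<and>
    f {1,3} + f {1,4} + f {1,5} + f {1,6} = 0 \<and> f {2,3} + f {2,4} + f {2,5} + f {2,6} = 0 \<and>
    f {1,3} + f {2,3} + f {3,5} + f {3,6} = 0 \<and> f {1,4} + f {2,4} + f {4,5} + f {4,6} = 0 \<and>
    f {1,5} + f {2,5} + f {3,5} + f {4,5} = 0 \<and> f {1,6} + f {2,6} + f {3,6} + f {4,6} = 0"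
  using sum_edges_at[of f] by (simp add: cycle_space_def verts_eq)

lemma triangle_vec_edge: "triangle_vec T {a, b} = (if a \<in> T \<and> b \<in> T \<and> a \<noteq> b then 1 else 0)"
  by (cases "a = b") (auto simp: triangle_vec_def indicator_def numeral_2_eq_2)

lemma triangle_vec_outside:
  assumes "T \<in> triangles" "e \<notin> \<Gamma>\<^sub>O"
  shows "triangle_vec T e = 0"
proof -
  obtain i j k where T: "T = {i, j, k}" "{i, j} \<in> \<Gamma>\<^sub>O" "{i, k} \<in> \<Gamma>\<^sub>O" "{j, k} \<in> \<Gamma>\<^sub>O"
    using assms unfolding triangles_def by blast
  have "\<not> (e \<subseteq> T \<and> card e = 2)"
  proof
    assume e: "e \<subseteq> T \<and> card e = 2"
    then obtain a b where "e = {a, b}" "a \<noteq> b" by (auto simp: card_2_iff)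
    then show False using e T assms(2) by (auto simp: insert_commute)
  qed
  then show ?thesis by (simp add: triangle_vec_def)
qed

lemma triangle_vec_in_cycle_space:
  assumes "T \<in> triangles"
  shows "triangle_vec T \<in> cycle_space"
  unfolding cycle_space_iff
proof (intro conjI)
  show "\<forall>e. e \<notin> \<Gamma>\<^sub>O \<longrightarrow> triangle_vec T e = 0" using triangle_vec_outside[OF assms] by blast
qed (use assms[unfolded triangles_eq] in \<open>elim insertE emptyE; simp add: triangle_vec_edge\<close>)+

lemma subspace_cycle_space: "F2.subspace cycle_space"
  unfolding F2.subspace_def cycle_space_def
  by (auto simp: sum.distrib sum_distrib_left[symmetric])

text \<open>The functions vanishing at \<open>e\<close> form a subspace containing \<open>S\<close>
  but not \<open>a\<close>. Independence thus reduces to exhibiting one new edge per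
  triangle.\<close>

lemma not_in_F2_span:
  assumes "a e \<noteq> (0::bit)" "\<And>v. v \<in> S \<Longrightarrow> v e = 0"
  shows "a \<notin> F2.span S"
proof -
  have "F2.subspace {f. f e = 0}" by (auto simp: F2.subspace_def)
  then have "F2.span S \<subseteq> {f. f e = 0}" using assms(2) by (intro F2.span_minimal) auto
  then show ?thesis using assms(1) by auto
qed

text \<open>The triangle \<open>{1,3,5}\<close> is left out. In the order of insertion each triangle has an edge
  that lies on none of the previous ones.\<close>

definition triangle_basis :: "(nat set \<Rightarrow> bit) set" where
  "triangle_basis = triangle_vec ` {{1,3,6},{1,4,5},{2,3,5},{1,4,6},{2,3,6},{2,4,5},{2,4,6}}"

lemma triangle_basis_independent: "F2.independent triangle_basis" (is ?ind)
  and card_triangle_basis: "card triangle_basis = 7" (is ?card)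
proof -
  have step: "F2.independent (insert a S) \<and> card (insert a S) = Suc n"
    if "F2.independent S \<and> card S = n" "finite S" "a e \<noteq> 0" "\<forall>v\<in>S. v e = 0" for a S n e
  proof -
    have "a \<notin> F2.span S" using that(3,4) not_in_F2_span by blast
    then show ?thesis
      using that(1,2) F2.independent_insertI[of a S] F2.span_base[of a S]
      by (metis card_insert_disjoint)
  qed
  note [simp] = triangle_vec_edge
  have "F2.independent {} \<and> card ({} :: (nat set \<Rightarrow> bit) set) = 0"
    by (simp add: F2.independent_empty)
  from step[OF this, of "triangle_vec {2,4,6}" "{2,4}"]
  have "F2.independent {triangle_vec {2,4,6}} \<and> card {triangle_vec {2,4,6}} = 1"
    by (simp add: One_nat_def)
  from step[OF this, of "triangle_vec {2,4,5}" "{2,5}"]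
  have "F2.independent {triangle_vec {2,4,5}, triangle_vec {2,4,6}} \<and>
      card {triangle_vec {2,4,5}, triangle_vec {2,4,6}} = 2" by simp
  from step[OF this, of "triangle_vec {2,3,6}" "{3,6}"]
  have "F2.independent (triangle_vec ` {{2,3,6},{2,4,5},{2,4,6}}) \<and>
      card (triangle_vec ` {{2,3,6},{2,4,5},{2,4,6}}) = 3" by simp
  from step[OF this, of "triangle_vec {1,4,6}" "{1,4}"]
  have "F2.independent (triangle_vec ` {{1,4,6},{2,3,6},{2,4,5},{2,4,6}}) \<and>
      card (triangle_vec ` {{1,4,6},{2,3,6},{2,4,5},{2,4,6}}) = 4" by simp
  from step[OF this, of "triangle_vec {2,3,5}" "{3,5}"]
  have "F2.independent (triangle_vec ` {{2,3,5},{1,4,6},{2,3,6},{2,4,5},{2,4,6}}) \<and>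
      card (triangle_vec ` {{2,3,5},{1,4,6},{2,3,6},{2,4,5},{2,4,6}}) = 5" by simp
  from step[OF this, of "triangle_vec {1,4,5}" "{1,5}"]
  have "F2.independent (triangle_vec ` {{1,4,5},{2,3,5},{1,4,6},{2,3,6},{2,4,5},{2,4,6}}) \<and>
      card (triangle_vec ` {{1,4,5},{2,3,5},{1,4,6},{2,3,6},{2,4,5},{2,4,6}}) = 6" by simp
  from step[OF this, of "triangle_vec {1,3,6}" "{1,3}"]
  have "F2.independent triangle_basis \<and> card triangle_basis = 7"
    unfolding triangle_basis_def by simp
  then show ?ind ?card by simp_all
qed

lemma cycle_space_subset_span: "cycle_space \<subseteq> F2.span triangle_basis"
proof
  fix f assume f: "f \<in> cycle_space"
  \<comment> \<open>By planar duality a cycle is a coboundary on the cube whose vertices are the triangles;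
    the coefficients form a potential vanishing at \<open>{1,3,5}\<close>.\<close>
  define g where "g = (\<lambda>e. f {1,3} * triangle_vec {1,3,6} e) + (\<lambda>e. f {1,5} * triangle_vec {1,4,5} e)
    + (\<lambda>e. f {3,5} * triangle_vec {2,3,5} e) + (\<lambda>e. (f {1,5} + f {1,4}) * triangle_vec {1,4,6} e)
    + (\<lambda>e. (f {3,5} + f {2,3}) * triangle_vec {2,3,6} e)
    + (\<lambda>e. (f {3,5} + f {2,5}) * triangle_vec {2,4,5} e)
    + (\<lambda>e. (f {3,5} + f {2,5} + f {2,4}) * triangle_vec {2,4,6} e)"
  have "g \<in> F2.span triangle_basis"
    unfolding g_def triangle_basis_def by (intro F2.span_add F2.span_scale F2.span_base) simp_all
  moreover have "f e = g e" for e
  proof (cases "e \<in> \<Gamma>\<^sub>O")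
    case False
    have "f e = 0" using f False by (simp add: cycle_space_def)
    then show ?thesis using triangle_vec_outside[OF _ False] by (simp add: g_def triangles_eq)
  next
    case True
    have cancel: "x + x = 0" for x :: bit by (cases x) auto
    have cancel': "x + (x + y) = y" for x y :: bit by (cases x; cases y) auto
    have eq: "d = a + b + c" if "a + b + c + d = 0" for a b c d :: bit
      using that by (cases a; cases b; cases c; cases d) auto
    \<comment> \<open>The relations at vertices 1 to 4 eliminate the edges to 6, and the relation at
      5 eliminates 45. The seven remaining edge values are the free parameters entering
      \<open>g\<close>.\<close>
    have "f {1,6} = f {1,3} + f {1,4} + f {1,5}" "f {2,6} = f {2,3} + f {2,4} + f {2,5}"
      "f {3,6} = f {1,3} + f {2,3} + f {3,5}" "f {4,6} = f {1,4} + f {2,4} + f {4,5}"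
      "f {4,5} = f {1,5} + f {2,5} + f {3,5}"
      using f unfolding cycle_space_iff by (metis eq)+
    then show ?thesis
      using True unfolding \<Gamma>_eq
      by (elim insertE emptyE; simp add: g_def triangle_vec_edge cancel cancel' ac_simps)
  qed
  ultimately show "f \<in> F2.span triangle_basis" by (metis ext)
qed

lemma span_triangles: "F2.span (triangle_vec ` triangles) = cycle_space"
proof
  show "F2.span (triangle_vec ` triangles) \<subseteq> cycle_space"
    using triangle_vec_in_cycle_space subspace_cycle_space by (intro F2.span_minimal) auto
  have "F2.span triangle_basis \<subseteq> F2.span (triangle_vec ` triangles)"
    by (intro F2.span_mono) (auto simp: triangle_basis_def triangles_eq)
  then show "cycle_space \<subseteq> F2.span (triangle_vec ` triangles)"
    using cycle_space_subset_span by blast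
qed

text \<open>Agrees with the cycle rank 12 - 6 + 1 of a connected graph. Every edge lies on exactly
  two triangles, so the eight triangle vectors sum to zero and at most seven of them can be
  independent.\<close>

lemma dim_cycle_space: "F2.dim cycle_space = 7"
proof (rule F2.dim_unique[OF _ cycle_space_subset_span triangle_basis_independent card_triangle_basis])
  show "triangle_basis \<subseteq> cycle_space"
    unfolding triangle_basis_def by (auto intro!: triangle_vec_in_cycle_space simp: triangles_eq)
qed

section \<open>Facets of the truncated octahedron\<close>

abbreviation zono :: "nat set \<Rightarrow> (real^3) set" where
  "zono J \<equiv> (\<Sum>j\<in>J. seg j)"

definition supp :: "real^3 \<Rightarrow> nat set \<Rightarrow> real" where
  "supp a J = (\<Sum>j\<in>J. \<bar>a \<bullet> r j\<bar> / 2)"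

text \<open>The centre of the face in direction \<open>a\<close>: generators not orthogonal to
  \<open>a\<close> sit at their extreme ends, and the others contribute their midpoint because
  \<open>sgn 0 = 0\<close>.\<close>

definition apex :: "real^3 \<Rightarrow> nat set \<Rightarrow> real^3" where
  "apex a J = (\<Sum>j\<in>J. (sgn (a \<bullet> r j) / 2) *\<^sub>R r j)"

definition perp :: "real^3 \<Rightarrow> nat set \<Rightarrow> nat set" where
  "perp a J = {j\<in>J. a \<bullet> r j = 0}"

lemma mem_seg: "x \<in> seg j \<longleftrightarrow> (\<exists>c. \<bar>c\<bar> \<le> 1/2 \<and> x = c *\<^sub>R r j)"
proof
  assume "x \<in> seg j"
  then obtain u where u: "0 \<le> u" "u \<le> 1" "x = (1 - u) *\<^sub>R (- (r j /\<^sub>R 2)) + u *\<^sub>R (r j /\<^sub>R 2)"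
    by (auto simp: seg_def in_segment)
  then have "x = (u - 1/2) *\<^sub>R r j" by (simp add: vec_eq_iff field_simps)
  moreover have "\<bar>u - 1/2\<bar> \<le> 1/2" using u by arith
  ultimately show "\<exists>c. \<bar>c\<bar> \<le> 1/2 \<and> x = c *\<^sub>R r j" by blast
next
  assume "\<exists>c. \<bar>c\<bar> \<le> 1/2 \<and> x = c *\<^sub>R r j"
  then obtain c where c: "\<bar>c\<bar> \<le> 1/2" "x = c *\<^sub>R r j" by blast
  have "x = (1 - (c + 1/2)) *\<^sub>R (- (r j /\<^sub>R 2)) + (c + 1/2) *\<^sub>R (r j /\<^sub>R 2)"
    unfolding c(2) by (simp add: vec_eq_iff field_simps)
  moreover have "0 \<le> c + 1/2" "c + 1/2 \<le> 1" using c(1) by arith+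
  ultimately show "x \<in> seg j" unfolding seg_def in_segment by blast
qed

lemma mem_zono:
  assumes "finite J"
  shows "x \<in> zono J \<longleftrightarrow> (\<exists>c. (\<forall>j\<in>J. \<bar>c j\<bar> \<le> 1/2) \<and> x = (\<Sum>j\<in>J. c j *\<^sub>R r j))"
proof
  assume "x \<in> zono J"
  then obtain s where s: "x = sum s J" "\<forall>j\<in>J. s j \<in> seg j"
    using set_sum_alt[OF assms, of seg] by auto
  then have "\<forall>j\<in>J. \<exists>c. \<bar>c\<bar> \<le> 1/2 \<and> s j = c *\<^sub>R r j" using mem_seg by blast
  then obtain c where "\<forall>j\<in>J. \<bar>c j\<bar> \<le> 1/2 \<and> s j = c j *\<^sub>R r j" by metis
  then show "\<exists>c. (\<forall>j\<in>J. \<bar>c j\<bar> \<le> 1/2) \<and> x = (\<Sum>j\<in>J. c j *\<^sub>R r j)" using s(1) by auto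
next
  assume "\<exists>c. (\<forall>j\<in>J. \<bar>c j\<bar> \<le> 1/2) \<and> x = (\<Sum>j\<in>J. c j *\<^sub>R r j)"
  then obtain c where c: "\<forall>j\<in>J. \<bar>c j\<bar> \<le> 1/2" "x = (\<Sum>j\<in>J. c j *\<^sub>R r j)" by blast
  have "\<forall>j\<in>J. c j *\<^sub>R r j \<in> seg j" using c(1) mem_seg by blast
  then show "x \<in> zono J" unfolding set_sum_alt[OF assms, of seg] c(2) by blast
qed

lemma zero_in_zono: "finite J \<Longrightarrow> 0 \<in> zono J"
  unfolding mem_zono by (intro exI[of _ "\<lambda>_. 0"]) auto

lemma half_generator_in_zono:
  assumes "finite J" "j \<in> J"
  shows "r j /\<^sub>R 2 \<in> zono J"
  unfolding mem_zono[OF assms(1)]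
proof (intro exI conjI)
  have "(\<Sum>i\<in>J. (if i = j then 1/2 else 0) *\<^sub>R r i) = (\<Sum>i\<in>J. if i = j then (1/2) *\<^sub>R r i else 0)"
    by (intro sum.cong) auto
  also have "\<dots> = r j /\<^sub>R 2" using assms by (simp add: inverse_eq_divide)
  finally show "r j /\<^sub>R 2 = (\<Sum>i\<in>J. (if i = j then 1/2 else 0) *\<^sub>R r i)" ..
qed auto

lemma polytope_zono:
  assumes "finite J"
  shows "polytope (zono J)"
proof -
  have "zono J = (\<Sum>j\<in>J. convex hull {- (r j /\<^sub>R 2), r j /\<^sub>R 2})"
    by (simp add: seg_def segment_convex_hull)
  also have "\<dots> = convex hull (\<Sum>j\<in>J. {- (r j /\<^sub>R 2), r j /\<^sub>R 2})"
    by (rule convex_hull_set_sum[symmetric])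
  finally show ?thesis
    unfolding polytope_def using finite_set_sum[of J "\<lambda>j. {- (r j /\<^sub>R 2), r j /\<^sub>R 2}"] by auto
qed

lemma zono_le_supp:
  assumes "finite J" "x \<in> zono J"
  shows "a \<bullet> x \<le> supp a J"
proof -
  obtain c where c: "\<forall>j\<in>J. \<bar>c j\<bar> \<le> 1/2" "x = (\<Sum>j\<in>J. c j *\<^sub>R r j)"
    using assms mem_zono by blast
  have "c j * (a \<bullet> r j) \<le> \<bar>a \<bullet> r j\<bar> / 2" if "j \<in> J" for j
  proof -
    have "c j * (a \<bullet> r j) \<le> \<bar>c j\<bar> * \<bar>a \<bullet> r j\<bar>" by (metis abs_ge_self abs_mult)
    also have "\<dots> \<le> 1/2 * \<bar>a \<bullet> r j\<bar>" using c(1) that by (intro mult_right_mono) auto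
    finally show ?thesis by simp
  qed
  then show ?thesis unfolding c(2) supp_def by (simp add: inner_sum_right sum_mono)
qed

text \<open>A point attaining the total bound attains it in every summand. This fixes the
  coefficient of each generator not orthogonal to \<open>a\<close> and leaves the others
  free.\<close>

lemma zono_face_eq:
  assumes "finite J"
  shows "zono J \<inter> {x. a \<bullet> x = supp a J} = (+) (apex a J) ` zono (perp a J)"
proof (intro equalityI subsetI)
  have fin: "finite (perp a J)" using assms by (simp add: perp_def)
  fix x assume "x \<in> zono J \<inter> {x. a \<bullet> x = supp a J}"
  then obtain c where c: "\<forall>j\<in>J. \<bar>c j\<bar> \<le> 1/2" "x = (\<Sum>j\<in>J. c j *\<^sub>R r j)" and x: "a \<bullet> x = supp a J"
    using assms mem_zono by blast
  have nn: "0 \<le> \<bar>a \<bullet> r j\<bar> / 2 - c j * (a \<bullet> r j)" if "j \<in> J" for j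
  proof -
    have "c j * (a \<bullet> r j) \<le> \<bar>c j\<bar> * \<bar>a \<bullet> r j\<bar>" by (metis abs_ge_self abs_mult)
    also have "\<dots> \<le> 1/2 * \<bar>a \<bullet> r j\<bar>" using c(1) that by (intro mult_right_mono) auto
    finally show ?thesis by simp
  qed
  have "(\<Sum>j\<in>J. \<bar>a \<bullet> r j\<bar> / 2 - c j * (a \<bullet> r j)) = 0"
    using x unfolding c(2) supp_def by (simp add: inner_sum_right sum_subtractf)
  then have "\<forall>j\<in>J. \<bar>a \<bullet> r j\<bar> / 2 - c j * (a \<bullet> r j) = 0"
    using nn by (subst (asm) sum_nonneg_eq_0_iff[OF assms]) auto
  then have "(sgn (a \<bullet> r j) / 2 - c j) * (a \<bullet> r j) = 0" if "j \<in> J" for j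
    using that by (simp add: abs_sgn algebra_simps)
  then have s: "c j = sgn (a \<bullet> r j) / 2" if "j \<in> J" "a \<bullet> r j \<noteq> 0" for j
    using that by force
  have "x = apex a J + (\<Sum>j\<in>J. if a \<bullet> r j = 0 then c j *\<^sub>R r j else 0)"
    unfolding c(2) apex_def sum.distrib[symmetric] using s by (intro sum.cong) auto
  also have "(\<Sum>j\<in>J. if a \<bullet> r j = 0 then c j *\<^sub>R r j else 0) = (\<Sum>j\<in>perp a J. c j *\<^sub>R r j)"
    unfolding perp_def by (rule sum.inter_filter[OF assms, symmetric])
  finally show "x \<in> (+) (apex a J) ` zono (perp a J)"
  proof (rule image_eqI)
    have "\<forall>j\<in>perp a J. \<bar>c j\<bar> \<le> 1/2" using c(1) by (simp add: perp_def)
    then show "(\<Sum>j\<in>perp a J. c j *\<^sub>R r j) \<in> zono (perp a J)" unfolding mem_zono[OF fin] by blast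
  qed
next
  have fin: "finite (perp a J)" using assms by (simp add: perp_def)
  fix x assume "x \<in> (+) (apex a J) ` zono (perp a J)"
  then obtain c where c: "\<forall>j\<in>perp a J. \<bar>c j\<bar> \<le> 1/2" "x = apex a J + (\<Sum>j\<in>perp a J. c j *\<^sub>R r j)"
    unfolding mem_zono[OF fin] image_iff bex_simps Bex_def by (elim exE conjE) simp
  define d where "d = (\<lambda>j. if a \<bullet> r j = 0 then c j else sgn (a \<bullet> r j) / 2)"
  have "(\<Sum>j\<in>perp a J. c j *\<^sub>R r j) = (\<Sum>j\<in>J. if a \<bullet> r j = 0 then c j *\<^sub>R r j else 0)"
    unfolding perp_def by (rule sum.inter_filter[OF assms])
  then have x: "x = (\<Sum>j\<in>J. d j *\<^sub>R r j)"
    unfolding c(2) apex_def by (simp add: sum.distrib[symmetric] d_def) (intro sum.cong, auto)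
  moreover have "\<forall>j\<in>J. \<bar>d j\<bar> \<le> 1/2" using c(1) by (auto simp: d_def perp_def sgn_if)
  ultimately have "x \<in> zono J" using mem_zono[OF assms] by blast
  moreover have "a \<bullet> x = supp a J"
    unfolding x inner_sum_right supp_def by (intro sum.cong) (auto simp: d_def sgn_if)
  ultimately show "x \<in> zono J \<inter> {x. a \<bullet> x = supp a J}" by simp
qed

lemma apex_in_zono_face:
  assumes "finite J"
  shows "apex a J \<in> zono J" "a \<bullet> apex a J = supp a J"
proof -
  have "finite (perp a J)" using assms by (simp add: perp_def)
  then have "apex a J + 0 \<in> (+) (apex a J) ` zono (perp a J)" using zero_in_zono by blast
  then show "apex a J \<in> zono J" "a \<bullet> apex a J = supp a J"
    unfolding zono_face_eq[OF assms, symmetric] by simp_all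
qed

lemma zono_face_of:
  assumes "finite J"
  shows "(zono J \<inter> {x. a \<bullet> x = supp a J}) face_of zono J"
  using zono_le_supp[OF assms] polytope_imp_convex[OF polytope_zono[OF assms]]
  by (intro face_of_Int_supporting_hyperplane_le) auto

text \<open>Faces of a polyhedron are exposed. Nonemptiness bounds the level of the supporting
  hyperplane by \<open>supp a J\<close> from above, and the point \<open>apex a J\<close> of the
  zonotope bounds it from below.\<close>

lemma zono_faceE:
  assumes "finite J" "F face_of zono J" "F \<noteq> {}"
  obtains a where "F = zono J \<inter> {x. a \<bullet> x = supp a J}"
proof -
  have "F exposed_face_of zono J"
    using exposed_face_of_polyhedron[OF polytope_imp_polyhedron[OF polytope_zono[OF assms(1)]]] assms(2)
    by blast
  then obtain a b where ab: "zono J \<subseteq> {x. a \<bullet> x \<le> b}" "F = zono J \<inter> {x. a \<bullet> x = b}"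
    unfolding exposed_face_of_def by blast
  obtain x where "x \<in> F" using assms(3) by blast
  then have "b \<le> supp a J" using ab(2) zono_le_supp[OF assms(1), of x a] by auto
  moreover have "supp a J \<le> b" using ab(1) apex_in_zono_face[OF assms(1), of a] by auto
  ultimately show ?thesis using ab(2) that by auto
qed

text \<open>The zonotope contains 0 and half of every generator, so its affine hull is the linear
  span of the generators.\<close>

lemma aff_dim_zono:
  assumes "finite J"
  shows "aff_dim (zono J) = int (dim (r ` J))"
proof -
  have "zono J \<subseteq> span (r ` J)"
    by (auto simp: mem_zono[OF assms] intro!: span_sum span_scale intro: span_base[OF imageI])
  moreover have "r ` J \<subseteq> span (zono J)"
  proof
    fix x assume "x \<in> r ` J"
    then obtain j where "j \<in> J" "x = r j" by blast
    then have "2 *\<^sub>R (x /\<^sub>R 2) \<in> span (zono J)"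
      using half_generator_in_zono[OF assms] by (intro span_scale span_base) auto
    then show "x \<in> span (zono J)" by simp
  qed
  ultimately have "span (zono J) = span (r ` J)" by (simp add: span_eq)
  then have "dim (zono J) = dim (r ` J)" by (metis dim_span)
  then show ?thesis using zero_in_zono[OF assms] by (simp add: aff_dim_zero hull_inc)
qed

text \<open>An extreme point is a one-point face, and any generator orthogonal to its direction
  would enlarge that face to contain a segment.\<close>

lemma extreme_point_zono:
  assumes "finite J" "\<And>j. j \<in> J \<Longrightarrow> r j \<noteq> 0"
  shows "x extreme_point_of zono J \<longleftrightarrow> (\<exists>a. perp a J = {} \<and> x = apex a J)"
proof
  assume "x extreme_point_of zono J"
  then have "{x} face_of zono J" by (simp add: face_of_singleton)
  then obtain a where "{x} = zono J \<inter> {x. a \<bullet> x = supp a J}"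
    using zono_faceE[OF assms(1)] by (metis insert_not_empty)
  then have x: "{x} = (+) (apex a J) ` zono (perp a J)" by (simp add: zono_face_eq[OF assms(1)])
  have fin: "finite (perp a J)" using assms(1) by (simp add: perp_def)
  have eq: "apex a J + y = x" if "y \<in> zono (perp a J)" for y using that x by blast
  have "perp a J = {}"
  proof (rule ccontr)
    assume "perp a J \<noteq> {}"
    then obtain j where j: "j \<in> perp a J" by blast
    then have "r j \<noteq> 0" using assms(2) by (auto simp: perp_def)
    moreover have "apex a J + 0 = apex a J + r j /\<^sub>R 2"
      using eq[OF zero_in_zono[OF fin]] eq[OF half_generator_in_zono[OF fin j]] by simp
    ultimately show False by simp
  qed
  then show "\<exists>a. perp a J = {} \<and> x = apex a J" using eq[OF zero_in_zono[OF fin]] by auto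
next
  assume "\<exists>a. perp a J = {} \<and> x = apex a J"
  then obtain a where "perp a J = {}" "x = apex a J" by blast
  then have "zono J \<inter> {x. a \<bullet> x = supp a J} = {x}" by (simp add: zono_face_eq[OF assms(1)])
  then show "x extreme_point_of zono J"
    using zono_face_of[OF assms(1), of a] by (simp add: face_of_singleton)
qed

section \<open>Vertices of a hexagonal zonotope\<close>

text \<open>Solves the two-by-two Gram system by Cramer's rule, so that directions with prescribed
  products with two generators are available.\<close>

lemma dual_vector:
  fixes u v :: "'a::real_inner"
  assumes "norm u = 1" "norm v = 1" "(u \<bullet> v)\<^sup>2 \<noteq> 1"
  obtains b where "b \<bullet> u = p" "b \<bullet> v = q"
proof
  define c where "c = u \<bullet> v"
  have g: "u \<bullet> u = 1" "v \<bullet> v = 1" "u \<bullet> v = c" "v \<bullet> u = c"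
    using assms by (simp_all add: norm_eq_1 c_def inner_commute)
  have n: "1 - c * c \<noteq> 0" using assms(3) by (simp add: c_def power2_eq_square)
  let ?b = "((p - c * q) / (1 - c * c)) *\<^sub>R u + ((q - c * p) / (1 - c * c)) *\<^sub>R v"
  have "?b \<bullet> u = (p - c * q + (q - c * p) * c) / (1 - c * c)"
    "?b \<bullet> v = ((p - c * q) * c + (q - c * p)) / (1 - c * c)"
    by (simp_all add: inner_add_left g add_divide_distrib)
  moreover have "p - c * q + (q - c * p) * c = p * (1 - c * c)"
    "(p - c * q) * c + (q - c * p) = q * (1 - c * c)" by (simp_all add: algebra_simps)
  ultimately show "?b \<bullet> u = p" "?b \<bullet> v = q" using n by simp_all
qed

text \<open>Vertices correspond to the sign patterns of \<open>p\<close>, \<open>p + q\<close> and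
  \<open>q\<close>. Of the eight patterns, the two in which \<open>p\<close> and \<open>q\<close>
  share a sign opposite to that of \<open>p + q\<close> cannot occur.\<close>

lemma card_vertices_coplanar_zono:
  assumes "i \<in> verts" "j \<in> verts" "k \<in> verts" "i \<noteq> j" "i \<noteq> k" "j \<noteq> k"
    and rel: "r j = r i + \<tau> *\<^sub>R r k" and \<tau>: "\<tau> = 1 \<or> \<tau> = -1"
  shows "card {v. v extreme_point_of zono {i, j, k}} = 6"
proof -
  \<comment> \<open>Coordinates on the plane of the generators, with the third one oriented so that
    \<open>r j\<close> is \<open>P (1, 1)\<close>. The set \<open>S\<close> below lists the six
    vertices in these coordinates.\<close>
  define P where "P = (\<lambda>(x::real, y::real). x *\<^sub>R r i + (\<tau> * y) *\<^sub>R r k)"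
  define S :: "(real \<times> real) set" where "S = {(1,1), (-1,-1), (1,0), (0,1), (0,-1), (-1,0)}"
  have c1: "(r i \<bullet> r k)\<^sup>2 \<noteq> 1"
    using half_gram_det(2)[of 0 0] r_inner_cases[OF assms(1,3,5)] by simp
  note dual = dual_vector[OF norm_r[OF assms(1)] norm_r[OF assms(3)] c1]
  have inj: "inj P"
  proof (rule injI)
    fix a b assume e: "P a = P b"
    obtain d d' where d: "d \<bullet> r i = 1" "d \<bullet> r k = 0" "d' \<bullet> r i = 0" "d' \<bullet> r k = 1"
      using dual by metis
    have "d \<bullet> P a = d \<bullet> P b" "d' \<bullet> P a = d' \<bullet> P b" using e by simp_all
    then show "a = b"
      using d \<tau> by (cases a; cases b) (auto simp: P_def inner_add_right)
  qed
  have sg: "sgn (\<tau> * x) = \<tau> * sgn x" for x using \<tau> by (auto simp: sgn_mult)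
  have ap: "apex a {i, j, k} = P ((sgn p + sgn (p + q)) / 2, (sgn q + sgn (p + q)) / 2)"
    and pe: "perp a {i, j, k} = {} \<longleftrightarrow> p \<noteq> 0 \<and> p + q \<noteq> 0 \<and> q \<noteq> 0"
    if "a \<bullet> r i = p" "a \<bullet> r k = \<tau> * q" for a p q
  proof -
    have aj: "a \<bullet> r j = p + q" unfolding rel using \<tau> that by (auto simp: inner_add_right)
    have t2: "\<tau> * \<tau> = 1" using \<tau> by auto
    have "apex a {i, j, k} = (sgn p / 2) *\<^sub>R r i + (sgn (p + q) / 2) *\<^sub>R (r i + \<tau> *\<^sub>R r k)
        + (\<tau> * sgn q / 2) *\<^sub>R r k"
      using assms(4-6) that aj sg by (simp add: apex_def rel[symmetric])
    also have "\<dots> = P ((sgn p + sgn (p + q)) / 2, (sgn q + sgn (p + q)) / 2)"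
      by (simp add: P_def algebra_simps add_divide_distrib)
    finally show "apex a {i, j, k} = P ((sgn p + sgn (p + q)) / 2, (sgn q + sgn (p + q)) / 2)" .
    show "perp a {i, j, k} = {} \<longleftrightarrow> p \<noteq> 0 \<and> p + q \<noteq> 0 \<and> q \<noteq> 0"
      using that aj \<tau> by (auto simp: perp_def)
  qed
  have "{v. v extreme_point_of zono {i, j, k}} = P ` S"
  proof (intro equalityI subsetI)
    fix v assume "v \<in> {v. v extreme_point_of zono {i, j, k}}"
    moreover have "r l \<noteq> 0" if "l \<in> {i, j, k}" for l
      using that assms norm_r by (metis insertE norm_zero singletonD zero_neq_one)
    ultimately obtain a where a: "perp a {i, j, k} = {}" "v = apex a {i, j, k}"
      using extreme_point_zono[of "{i, j, k}" v] by auto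
    define p q where "p = a \<bullet> r i" and "q = \<tau> * (a \<bullet> r k)"
    have pq: "a \<bullet> r i = p" "a \<bullet> r k = \<tau> * q" using \<tau> by (auto simp: p_def q_def)
    have "((sgn p + sgn (p + q)) / 2, (sgn q + sgn (p + q)) / 2) \<in> S"
      using a(1) unfolding pe[OF pq] by (auto simp: S_def sgn_if)
    then show "v \<in> P ` S" unfolding a(2) ap[OF pq] by blast
  next
    fix v assume "v \<in> P ` S"
    then obtain s where s: "s \<in> S" "v = P s" by blast
    have "\<exists>p q. p \<noteq> 0 \<and> p + q \<noteq> 0 \<and> q \<noteq> 0 \<and> s = ((sgn p + sgn (p + q)) / 2, (sgn q + sgn (p + q)) / 2)"
      \<comment> \<open>Equal signs give the two points with equal coordinates; for opposite signs
        the entry of modulus 2 decides the sign of \<open>p + q\<close>.\<close>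
      using s(1) unfolding S_def
    proof (elim insertE emptyE)
      assume "s = (1, 1)" then show ?thesis by (intro exI[of _ 1] exI[of _ 1]) simp
    next
      assume "s = (-1, -1)" then show ?thesis by (intro exI[of _ "-1"] exI[of _ "-1"]) simp
    next
      assume "s = (1, 0)" then show ?thesis by (intro exI[of _ 2] exI[of _ "-1"]) simp
    next
      assume "s = (0, 1)" then show ?thesis by (intro exI[of _ "-1"] exI[of _ 2]) simp
    next
      assume "s = (0, -1)" then show ?thesis by (intro exI[of _ 1] exI[of _ "-2"]) simp
    next
      assume "s = (-1, 0)" then show ?thesis by (intro exI[of _ "-2"] exI[of _ 1]) simp
    qed
    then obtain p q where pq: "p \<noteq> 0 \<and> p + q \<noteq> 0 \<and> q \<noteq> 0"
      "s = ((sgn p + sgn (p + q)) / 2, (sgn q + sgn (p + q)) / 2)" by blast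
    obtain a where a: "a \<bullet> r i = p" "a \<bullet> r k = \<tau> * q" using dual by metis
    moreover have "r l \<noteq> 0" if "l \<in> {i, j, k}" for l
      using that assms norm_r by (metis insertE norm_zero singletonD zero_neq_one)
    ultimately show "v \<in> {v. v extreme_point_of zono {i, j, k}}"
      using ap[OF a] pe[OF a] pq s(2) extreme_point_zono[of "{i, j, k}" v] by auto
  qed
  then have "card {v. v extreme_point_of zono {i, j, k}} = card S"
    using inj by (simp add: card_image inj_on_subset)
  then show ?thesis by (simp add: S_def)
qed

lemma trunc_oct_zono: "trunc_oct = zono verts"
  by (simp add: trunc_oct_def)

lemma finite_verts: "finite verts" by (simp add: verts_def)

abbreviation face :: "real^3 \<Rightarrow> (real^3) set" where
  "face a \<equiv> trunc_oct \<inter> {x. a \<bullet> x = supp a verts}"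

lemmas face_eq = zono_face_eq[OF finite_verts, folded trunc_oct_zono]

lemma finite_perp: "finite J \<Longrightarrow> finite (perp a J)"
  by (simp add: perp_def)

lemma aff_dim_face: "aff_dim (face a) = int (dim (r ` perp a verts))"
  by (simp add: face_eq aff_dim_translation_eq aff_dim_zono finite_perp finite_verts)

lemma aff_dim_trunc_oct: "aff_dim trunc_oct = 3"
proof -
  have "independent {r 1, r 3, r 5}"
    by (subst dependent_r_iff) (simp_all add: verts_iff switching_class_def r_gram)
  moreover have "card {r 1, r 3, r 5} = 3"
    by (simp add: r_inj verts_iff)
  ultimately have "3 \<le> dim (r ` verts)"
    using independent_card_le_dim[of "{r 1, r 3, r 5}" "r ` verts"] by (auto simp: verts_iff)
  moreover have "dim (r ` verts) \<le> 3" using dim_subset_UNIV[of "r ` verts"] by simp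
  ultimately show ?thesis by (simp add: trunc_oct_zono aff_dim_zono[OF finite_verts])
qed

lemma facet_iff:
  "F facet_of trunc_oct \<longleftrightarrow> (\<exists>a. a \<noteq> 0 \<and> dim (r ` perp a verts) = 2 \<and> F = face a)"
proof
  assume F: "F facet_of trunc_oct"
  then have d: "aff_dim F = 2" "F \<noteq> {}" "F face_of trunc_oct"
    by (auto simp: facet_of_def aff_dim_trunc_oct)
  then obtain a where a: "F = face a"
    using zono_faceE[OF finite_verts] unfolding trunc_oct_zono by metis
  have "a \<noteq> 0"
  proof
    assume "a = 0"
    then have "F = trunc_oct" unfolding a by (simp add: supp_def)
    then show False using d(1) aff_dim_trunc_oct by simp
  qed
  then show "\<exists>a. a \<noteq> 0 \<and> dim (r ` perp a verts) = 2 \<and> F = face a"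
    using d(1) a aff_dim_face[of a] by auto
next
  assume "\<exists>a. a \<noteq> 0 \<and> dim (r ` perp a verts) = 2 \<and> F = face a"
  then obtain a where a: "dim (r ` perp a verts) = 2" "F = face a" by blast
  have "F face_of trunc_oct"
    using zono_face_of[OF finite_verts] by (simp add: a(2) trunc_oct_zono)
  moreover have "F \<noteq> {}"
    using apex_in_zono_face[OF finite_verts] by (auto simp: a(2) trunc_oct_zono)
  ultimately show "F facet_of trunc_oct"
    by (simp add: facet_of_def aff_dim_trunc_oct a aff_dim_face)
qed

section \<open>Classification of facet normals\<close>

lemma vector3_eq_iff: "(vector [a, b, c] :: 'a::zero^3) = vector [a', b', c'] \<longleftrightarrow> a = a' \<and> b = b' \<and> c = c'"
  by (simp add: vec_eq_iff forall_3 vector_3)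

lemma uminus_vector3: "- (vector [a, b, c] :: real^3) = vector [- a, - b, - c]"
  by (simp add: vec_eq_iff forall_3 vector_3)

text \<open>One representative of each antipodal pair of cube vertices; the opposite facets are
  obtained through \<open>uminus\<close>.\<close>

definition hex_normals :: "(real^3) set" where
  "hex_normals = {vector [1,1,1], vector [1,1,-1], vector [1,-1,1], vector [1,-1,-1]}"

definition square_normals :: "(real^3) set" where
  "square_normals = {vector [1,0,0], vector [0,1,0], vector [0,0,1]}"

definition normals :: "(real^3) set" where
  "normals = hex_normals \<union> square_normals"

lemma perp_normal:
  "perp (vector [1,1,1]) verts = {2,4,6}" "perp (vector [1,1,-1]) verts = {2,3,5}"
  "perp (vector [1,-1,1]) verts = {1,4,5}" "perp (vector [1,-1,-1]) verts = {1,3,6}"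
  "perp (vector [1,0,0]) verts = {5,6}" "perp (vector [0,1,0]) verts = {3,4}"
  "perp (vector [0,0,1]) verts = {1,2}"
  unfolding perp_def verts_eq by (simp_all only: Collect_insert_conj inner_r vector_3) simp_all

lemma perp_uminus [simp]: "perp (- a) J = perp a J"
  by (simp add: perp_def)

lemma perp_hex_normals: "(\<lambda>n. perp n verts) ` hex_normals = coplanar_triples"
  by (auto simp: hex_normals_def perp_normal coplanar_triples_eq)

lemma perp_square_normals: "(\<lambda>n. perp n verts) ` square_normals = orth_pairs"
  by (auto simp: square_normals_def perp_normal orth_pairs_eq)

lemma inj_perp_normals: "inj_on (\<lambda>n. perp n verts) normals"
  unfolding normals_def hex_normals_def square_normals_def
  by (simp add: perp_normal set_eq_subset vector3_eq_iff insert_Diff_if)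

lemma normals_nonzero: "n \<in> normals \<Longrightarrow> n \<noteq> 0"
  by (auto simp: normals_def hex_normals_def square_normals_def vec_eq_iff forall_3 vector_3)

text \<open>Two distinct generators are never parallel, which gives at least 2; the plane orthogonal
  to \<open>a\<close> gives at most 2.\<close>

lemma dim_two:
  assumes "i \<in> verts" "j \<in> verts" "i \<noteq> j" "i \<in> J" "j \<in> J" "a \<noteq> 0" "\<And>k. k \<in> J \<Longrightarrow> a \<bullet> r k = 0"
  shows "dim (r ` J) = 2"
proof -
  have "independent {r i, r j}"
  proof
    assume "dependent {r i, r j}"
    moreover have "r i \<noteq> 0" "r j \<noteq> 0" using norm_r assms(1,2) by (metis norm_zero zero_neq_one)+
    ultimately have "r i \<in> span {r j}"
      using r_inj[OF assms(1-3)] independent_insert[of "r i" "{r j}"] by auto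
    then obtain c where c: "r i = c *\<^sub>R r j" by (auto simp: span_singleton)
    have "r i \<bullet> r j = c" "r i \<bullet> r i = c * (r i \<bullet> r j)"
      using r_gram(1)[OF assms(2)] by (simp_all add: c inner_commute)
    then have "(r i \<bullet> r j)\<^sup>2 = 1" using r_gram(1)[OF assms(1)] by (simp add: power2_eq_square)
    then show False using half_gram_det(2)[of 0 0] r_inner_cases[OF assms(1-3)] by simp
  qed
  moreover have "card {r i, r j} = 2" using r_inj[OF assms(1-3)] by simp
  ultimately have "2 \<le> dim (r ` J)"
    using independent_card_le_dim[of "{r i, r j}" "r ` J"] assms(4,5) by auto
  moreover have "dim (r ` J) \<le> dim {x. a \<bullet> x = 0}"
    using assms(7) by (intro dim_subset) auto
  moreover have "dim {x. a \<bullet> x = 0} = 2" using dim_hyperplane[OF assms(6)] by simp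
  ultimately show ?thesis by simp
qed

lemma dim_perp_normal:
  assumes "n \<in> normals"
  shows "dim (r ` perp n verts) = 2"
proof -
  have "\<exists>i\<in>perp n verts. \<exists>j\<in>perp n verts. i \<noteq> j"
    using assms unfolding normals_def hex_normals_def square_normals_def Un_iff
    by (elim disjE insertE emptyE; hypsubst; unfold perp_normal; simp; blast)
  then obtain i j where "i \<in> verts" "j \<in> verts" "i \<noteq> j" "i \<in> perp n verts" "j \<in> perp n verts"
    by (auto simp: perp_def)
  then show ?thesis
    using normals_nonzero[OF assms] by (rule dim_two) (simp add: perp_def)
qed

lemma face_uminus: "face (- a) = uminus ` face a"
proof -
  have m: "- x \<in> trunc_oct" if x: "x \<in> trunc_oct" for x
  proof -
    obtain c where c: "\<forall>j\<in>verts. \<bar>c j\<bar> \<le> 1/2" "x = (\<Sum>j\<in>verts. c j *\<^sub>R r j)"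
      using x unfolding trunc_oct_zono mem_zono[OF finite_verts] by blast
    then show ?thesis unfolding trunc_oct_zono mem_zono[OF finite_verts]
      by (intro exI[of _ "\<lambda>j. - c j"]) (simp add: sum_negf)
  qed
  have sa: "supp (- a) verts = supp a verts" by (simp add: supp_def)
  show ?thesis
  proof (intro equalityI subsetI)
    fix x assume "x \<in> face (- a)"
    then have "- x \<in> face a" using m[of x] by (simp add: sa)
    then have "- (- x) \<in> uminus ` face a" by (rule imageI)
    then show "x \<in> uminus ` face a" by simp
  next
    fix x assume "x \<in> uminus ` face a"
    then obtain y where "x = - y" "y \<in> trunc_oct" "a \<bullet> y = supp a verts" by blast
    then show "x \<in> face (- a)" using m[of y] by (simp add: sa)
  qed
qed

lemma face_scaleR:
  assumes "0 < l"
  shows "face (l *\<^sub>R a) = face a"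
proof -
  have "supp (l *\<^sub>R a) verts = l * supp a verts"
    using assms by (simp add: supp_def abs_mult sum_distrib_left)
  then show ?thesis using assms by simp
qed

lemma perp_dim_two_normal:
  assumes "a \<noteq> 0" "dim (r ` perp a verts) = 2"
  shows "\<exists>n\<in>normals. \<exists>l>0. a = l *\<^sub>R n \<or> a = l *\<^sub>R (- n)"
proof -
  define x y z where "x = a$1" and "y = a$2" and "z = a$3"
  have "\<exists>i j. i \<in> perp a verts \<and> j \<in> perp a verts \<and> i \<noteq> j"
  proof (rule ccontr)
    assume "\<not> ?thesis"
    then have "card (perp a verts) \<le> 1"
      by (metis One_nat_def card_le_Suc0_iff_eq finite_perp finite_verts)
    moreover have "dim (r ` perp a verts) \<le> card (perp a verts)"
      using dim_le_card'[of "r ` perp a verts"] card_image_le[of "perp a verts" r]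
      by (simp add: finite_perp finite_verts)
    ultimately show False using assms(2) by simp
  qed
  then obtain i j where ij: "i \<in> verts" "j \<in> verts" "i \<noteq> j" "a \<bullet> r i = 0" "a \<bullet> r j = 0"
    by (auto simp: perp_def)
  have r0: "a \<bullet> r 1 = 0 \<longleftrightarrow> y = - x" "a \<bullet> r 2 = 0 \<longleftrightarrow> y = x"
    "a \<bullet> r 3 = 0 \<longleftrightarrow> z = - x" "a \<bullet> r 4 = 0 \<longleftrightarrow> z = x"
    "a \<bullet> r 5 = 0 \<longleftrightarrow> z = - y" "a \<bullet> r 6 = 0 \<longleftrightarrow> z = y"
    unfolding inner_r x_def y_def z_def by (simp; linarith)+
  \<comment> \<open>Each equation identifies two coordinates up to sign. Both opposite equations for
    the same two coordinates make these vanish; equations for different coordinate pairs make all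
    absolute values equal.\<close>
  have "(y = 0 \<and> z = 0) \<or> (x = 0 \<and> z = 0) \<or> (x = 0 \<and> y = 0) \<or> (\<bar>x\<bar> = \<bar>y\<bar> \<and> \<bar>y\<bar> = \<bar>z\<bar>)"
    using ij unfolding verts_iff by (elim disjE) (auto simp: r0)
  moreover have "x \<noteq> 0 \<or> y \<noteq> 0 \<or> z \<noteq> 0"
    using assms(1) by (simp add: vec_eq_iff forall_3 x_def y_def z_def)
  \<comment> \<open>The scale is the common absolute value of the nonzero coordinates, so
    \<open>a\<close> is a positive multiple of its vector of signs.\<close>
  ultimately have "\<exists>l>0. x = l * sgn x \<and> y = l * sgn y \<and> z = l * sgn z \<and>
      ((y = 0 \<and> z = 0) \<or> (x = 0 \<and> z = 0) \<or> (x = 0 \<and> y = 0) \<or> (x \<noteq> 0 \<and> y \<noteq> 0 \<and> z \<noteq> 0))"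
    by (intro exI[of _ "max \<bar>x\<bar> (max \<bar>y\<bar> \<bar>z\<bar>)"]) (auto simp: sgn_if abs_if)
  then obtain l where l: "l > 0" "x = l * sgn x" "y = l * sgn y" "z = l * sgn z"
    and c: "(y = 0 \<and> z = 0) \<or> (x = 0 \<and> z = 0) \<or> (x = 0 \<and> y = 0) \<or> (x \<noteq> 0 \<and> y \<noteq> 0 \<and> z \<noteq> 0)"
    by blast
  have nz: "\<not> (x = 0 \<and> y = 0 \<and> z = 0)"
    using assms(1) by (simp add: vec_eq_iff forall_3 x_def y_def z_def)
  have sgn_cases: "t = 0 \<or> sgn t = 1 \<or> sgn t = -1" for t :: real by (simp add: sgn_if)
  let ?n = "vector [sgn x, sgn y, sgn z] :: real^3"
  have "?n \<in> normals \<or> - ?n \<in> normals"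
    using c nz sgn_cases[of x] sgn_cases[of y] sgn_cases[of z]
    by (elim disjE conjE; simp add: normals_def hex_normals_def square_normals_def vector3_eq_iff uminus_vector3)
  moreover have "a = l *\<^sub>R ?n"
    using l by (simp add: vec_eq_iff forall_3 vector_3 x_def y_def z_def)
  ultimately show ?thesis using l(1) by (metis minus_minus)
qed

lemma facet_normal:
  "F facet_of trunc_oct \<longleftrightarrow> (\<exists>n\<in>normals. F = face n \<or> F = uminus ` face n)"
proof
  assume "F facet_of trunc_oct"
  then show "\<exists>n\<in>normals. F = face n \<or> F = uminus ` face n"
    using perp_dim_two_normal face_scaleR face_uminus unfolding facet_iff by metis
next
  assume "\<exists>n\<in>normals. F = face n \<or> F = uminus ` face n"
  then obtain n where n: "n \<in> normals" "F = face n \<or> F = face (- n)" using face_uminus by metis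
  have "n \<noteq> 0 \<and> dim (r ` perp n verts) = 2 \<and> - n \<noteq> 0 \<and> dim (r ` perp (- n) verts) = 2"
    using n(1) by (simp add: normals_nonzero dim_perp_normal)
  then show "F facet_of trunc_oct" using n(2) unfolding facet_iff by blast
qed

section \<open>Recovering generators from a facet\<close>

lemma face_translate_perp:
  assumes "J \<subseteq> verts" "face a = (+) t ` zono J"
  shows "J \<subseteq> perp a verts"
proof
  have fin: "finite J" using assms(1) finite_verts finite_subset by blast
  fix j assume j: "j \<in> J"
  have "t + 0 \<in> face a" "t + r j /\<^sub>R 2 \<in> face a"
    unfolding assms(2) using zero_in_zono[OF fin] half_generator_in_zono[OF fin j] by blast+
  then have "a \<bullet> r j = 0" by (simp add: inner_add_right)
  then show "j \<in> perp a verts" using j assms(1) by (auto simp: perp_def)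
qed

text \<open>\<open>a\<close> is constant on its own face and \<open>b\<close> is constant on the
  translate. As the two sets agree, each functional annihilates the generators along which the other
  description can move.\<close>

lemma face_translate_perp_eq:
  assumes "face a = (+) t ` zono (perp b verts)"
  shows "perp a verts = perp b verts"
proof
  show "perp b verts \<subseteq> perp a verts"
    using assms by (intro face_translate_perp[of _ a t]) (auto simp: perp_def)
  show "perp a verts \<subseteq> perp b verts"
  proof
    have fin: "finite (perp a verts)" "finite (perp b verts)" by (simp_all add: finite_perp finite_verts)
    have const: "b \<bullet> x = b \<bullet> t" if x: "x \<in> face a" for x
    proof -
      obtain y where "y \<in> zono (perp b verts)" "x = t + y" using x unfolding assms by blast
      moreover from this have "b \<bullet> y = 0"
        using fin(2) by (auto simp: mem_zono inner_sum_right perp_def intro!: sum.neutral)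
      ultimately show ?thesis by (simp add: inner_add_right)
    qed
    fix j assume j: "j \<in> perp a verts"
    have "apex a verts + 0 \<in> face a" "apex a verts + r j /\<^sub>R 2 \<in> face a"
      unfolding face_eq using zero_in_zono[OF fin(1)] half_generator_in_zono[OF fin(1) j] by blast+
    then have "b \<bullet> r j = 0" using const[of "apex a verts + 0"] const[of "apex a verts + r j /\<^sub>R 2"]
      by (simp add: inner_add_right)
    then show "j \<in> perp b verts" using j by (auto simp: perp_def)
  qed
qed

text \<open>A facet generated by these indices is a face of some \<open>m\<close> in
  \<open>normals\<close> or of its negative. The two generator sets then agree, and normals are
  determined by their generator sets.\<close>

lemma generates_normal:
  assumes "n \<in> normals"
  shows "{F. generates (perp n verts) F} = {face n, uminus ` face n}"
proof (intro equalityI subsetI)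
  fix F assume "F \<in> {F. generates (perp n verts) F}"
  then obtain t where F: "F facet_of trunc_oct" "F = (+) t ` zono (perp n verts)"
    unfolding generates_def by blast
  then obtain m where m: "m \<in> normals" "F = face m \<or> F = face (- m)"
    using facet_normal face_uminus by metis
  then have "perp m verts = perp n verts"
    using F(2) face_translate_perp_eq[of m t n] face_translate_perp_eq[of "- m" t n] by auto
  then have "m = n" using inj_perp_normals m(1) assms by (auto dest: inj_onD)
  then show "F \<in> {face n, uminus ` face n}" using m(2) face_uminus by blast
next
  fix F assume "F \<in> {face n, uminus ` face n}"
  then have F: "F facet_of trunc_oct" "F = face n \<or> F = face (- n)"
    using assms facet_normal face_uminus by blast+
  then have "\<exists>t. F = (+) t ` zono (perp n verts)"
    using face_eq[of n] face_eq[of "- n"] by auto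
  then show "F \<in> {F. generates (perp n verts) F}"
    unfolding generates_def using F(1) by simp
qed

text \<open>On the two faces \<open>a\<close> takes the values \<open>supp a verts\<close> and its
  negative. If they agree, the support value is 0 and \<open>a\<close> is orthogonal to the spanning
  generators 1, 2, 3.\<close>

lemma face_neq_uminus:
  assumes "a \<noteq> 0"
  shows "face a \<noteq> uminus ` face a"
proof
  assume e: "face a = uminus ` face a"
  have "apex a verts \<in> face a"
    using apex_in_zono_face[OF finite_verts] by (simp add: trunc_oct_zono)
  then have "apex a verts \<in> face a" "apex a verts \<in> uminus ` face a" using e by simp_all
  then have "supp a verts = 0" by auto
  then have "\<forall>j\<in>verts. \<bar>a \<bullet> r j\<bar> / 2 = 0"
    unfolding supp_def by (subst (asm) sum_nonneg_eq_0_iff) (auto simp: finite_verts)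
  then have "a \<bullet> r 1 = 0" "a \<bullet> r 2 = 0" "a \<bullet> r 3 = 0" by (auto simp: verts_iff)
  then have "a = 0" by (simp add: inner_r vec_eq_iff forall_3)
  then show False using assms by simp
qed

text \<open>Each normal contributes two distinct faces, and different normals share none because a
  face determines its generators.\<close>

lemma card_faces:
  assumes "N \<subseteq> normals"
  shows "card (\<Union>n\<in>N. {face n, uminus ` face n}) = 2 * card N"
proof -
  have "finite N" using assms
    by (rule finite_subset) (simp add: normals_def hex_normals_def square_normals_def)
  moreover have "{face m, uminus ` face m} \<inter> {face n, uminus ` face n} = {}"
    if "m \<in> N" "n \<in> N" "m \<noteq> n" for m n
  proof -
    have *: "perp m verts \<noteq> perp n verts"
      using that assms inj_perp_normals by (auto dest: inj_onD)
    have d: "face m' \<noteq> face n'" if "m' \<in> {m, - m}" "n' \<in> {n, - n}" for m' n'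
    proof
      assume "face m' = face n'"
      then have "face m' = (+) (apex n' verts) ` zono (perp n' verts)" by (simp add: face_eq)
      then have "perp m' verts = perp n' verts" by (rule face_translate_perp_eq)
      moreover have "perp m' verts = perp m verts" "perp n' verts = perp n verts" using that by auto
      ultimately show False using * by simp
    qed
    have "face m \<noteq> face n" "face m \<noteq> face (- n)" "face (- m) \<noteq> face n" "face (- m) \<noteq> face (- n)"
      by (rule d; simp)+
    then show ?thesis
      by (simp only: face_uminus[symmetric] Int_insert_left Int_empty_left insert_iff empty_iff simp_thms if_False)
  qed
  moreover have two: "card {face n, uminus ` face n} = 2" if "n \<in> N" for n
    using that assms normals_nonzero face_neq_uminus[of n] by (simp add: subset_iff)
  ultimately have "card (\<Union>n\<in>N. {face n, uminus ` face n}) = (\<Sum>n\<in>N. card {face n, uminus ` face n})"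
    by (intro card_UN_disjoint ballI impI) (simp_all only: finite.intros)
  also have "\<dots> = (\<Sum>n\<in>N. 2)" using two by (intro sum.cong refl)
  finally show ?thesis by simp
qed

section \<open>Telling squares from hexagons\<close>

lemma square_card_extreme_points:
  assumes "square F"
  shows "card {v. v extreme_point_of F} \<le> 4"
proof -
  obtain p u v where F: "F = convex hull {p, p + u, p + v, p + u + v}"
    using assms unfolding square_def by blast
  have "card {v. v extreme_point_of F} \<le> card {p, p + u, p + v, p + u + v}"
    using extreme_point_of_convex_hull unfolding F by (intro card_mono) blast+
  also have "\<dots> \<le> 4" by (simp add: card_insert_if)
  finally show ?thesis .
qed

lemma square_translate_zono:
  assumes "i \<in> verts" "j \<in> verts" "i \<noteq> j" "r i \<bullet> r j = 0"
  shows "square ((+) t ` zono {i, j})"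
proof -
  \<comment> \<open>The corner at which both generators are at their negative ends.\<close>
  define p where "p = t - r i /\<^sub>R 2 - r j /\<^sub>R 2"
  have "zono {i, j} = convex hull {- (r i /\<^sub>R 2), r i /\<^sub>R 2} + convex hull {- (r j /\<^sub>R 2), r j /\<^sub>R 2}"
    using assms(3) by (simp add: seg_def segment_convex_hull)
  also have "\<dots> = convex hull ({- (r i /\<^sub>R 2), r i /\<^sub>R 2} + {- (r j /\<^sub>R 2), r j /\<^sub>R 2})"
    by (rule convex_hull_set_plus[symmetric])
  finally have z: "(+) t ` zono {i, j} =
      convex hull ((+) t ` ({- (r i /\<^sub>R 2), r i /\<^sub>R 2} + {- (r j /\<^sub>R 2), r j /\<^sub>R 2}))"
    by (simp add: convex_hull_translation)
  have plus: "{- a, a} + {- b, b} = {- a - b, a - b, b - a, a + b}" for a b :: "real^3"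
    by (auto simp: set_plus_def)
  have "t + (r i /\<^sub>R 2 - r j /\<^sub>R 2) = p + r i" "t + (r j /\<^sub>R 2 - r i /\<^sub>R 2) = p + r j"
    "t + (r i /\<^sub>R 2 + r j /\<^sub>R 2) = p + r i + r j" "t + (- (r i /\<^sub>R 2) - r j /\<^sub>R 2) = p"
    unfolding p_def by (simp_all add: vec_eq_iff field_simps)
  then have "(+) t ` ({- (r i /\<^sub>R 2), r i /\<^sub>R 2} + {- (r j /\<^sub>R 2), r j /\<^sub>R 2})
      = {p, p + r i, p + r j, p + r i + r j}"
    unfolding plus by (simp only: image_insert image_empty)
  with z have "(+) t ` zono {i, j} = convex hull {p, p + r i, p + r j, p + r i + r j}" by (simp only:)
  moreover have "r i \<noteq> 0" "norm (r i) = norm (r j)"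
    using norm_r[OF assms(1)] norm_r[OF assms(2)] by auto
  ultimately show ?thesis using assms(4) unfolding square_def by blast
qed

lemma extreme_points_translate:
  "card {v. v extreme_point_of (+) t ` S} = card {v. v extreme_point_of S}"
  for S :: "'a::euclidean_space set"
proof -
  have "{v. v extreme_point_of (+) t ` S} = (+) t ` {v. v extreme_point_of S}"
  proof (intro equalityI subsetI)
    fix v assume "v \<in> {v. v extreme_point_of (+) t ` S}"
    then show "v \<in> (+) t ` {v. v extreme_point_of S}"
      using extreme_point_of_translation_eq[of t "v - t" S] by (auto simp: image_iff intro!: exI[of _ "v - t"])
  qed (auto simp: extreme_point_of_translation_eq)
  then show ?thesis by (simp add: card_image)
qed

lemma generates_square:
  assumes "P \<in> orth_pairs" "generates P F"
  shows "square F"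
proof -
  obtain i j where "P = {i, j}" "i \<in> verts" "j \<in> verts" "i \<noteq> j" "r i \<bullet> r j = 0"
    using assms(1) unfolding orth_pairs_def by blast
  then show ?thesis using assms(2) square_translate_zono unfolding generates_def by metis
qed

lemma card_vertices_coplanar_triple:
  assumes "T \<in> coplanar_triples"
  shows "card {v. v extreme_point_of zono T} = 6"
proof -
  \<comment> \<open>One linear relation per coplanar triple, written so that the middle index is the
    sum or difference of the outer two.\<close>
  have rel: "r 3 = r 1 + (-1) *\<^sub>R r 6" "r 4 = r 1 + (-1) *\<^sub>R r 5"
    "r 3 = r 2 + 1 *\<^sub>R r 5" "r 4 = r 2 + 1 *\<^sub>R r 6"
    by (simp_all add: vec_eq_iff forall_3 r_nth)
  from assms show ?thesis unfolding coplanar_triples_eq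
    by (elim insertE emptyE; hypsubst)
      (rule card_vertices_coplanar_zono[OF _ _ _ _ _ _ rel(1)]
        card_vertices_coplanar_zono[OF _ _ _ _ _ _ rel(2)]
        card_vertices_coplanar_zono[OF _ _ _ _ _ _ rel(3)]
        card_vertices_coplanar_zono[OF _ _ _ _ _ _ rel(4)]; simp add: verts_iff)+
qed

lemma generates_hexagon:
  assumes "T \<in> coplanar_triples" "generates T F"
  shows "hexagon F"
proof -
  obtain t where F: "F facet_of trunc_oct" "F = (+) t ` zono T"
    using assms(2) unfolding generates_def by blast
  have fin: "finite T" using assms(1) by (auto simp: coplanar_triples_eq)
  have "polytope F" using polytope_zono[OF fin] by (simp add: F(2) polytope_translation_eq)
  moreover have "aff_dim F = 2" using F(1) by (simp add: facet_of_def aff_dim_trunc_oct)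
  moreover have "card {v. v extreme_point_of F} = 6"
    unfolding F(2) extreme_points_translate by (rule card_vertices_coplanar_triple[OF assms(1)])
  ultimately show ?thesis by (simp add: hexagon_def)
qed

lemma facet_generated:
  "F facet_of trunc_oct \<longleftrightarrow> (\<exists>J\<in>coplanar_triples \<union> orth_pairs. generates J F)"
proof
  assume "F facet_of trunc_oct"
  then obtain n where n: "n \<in> normals" "F \<in> {face n, uminus ` face n}" using facet_normal by blast
  then have "generates (perp n verts) F" using generates_normal by blast
  moreover have "perp n verts \<in> coplanar_triples \<union> orth_pairs"
    using n(1) perp_hex_normals perp_square_normals by (auto simp: normals_def)
  ultimately show "\<exists>J\<in>coplanar_triples \<union> orth_pairs. generates J F" by blast
qed (auto simp: generates_def)

lemma not_hexagon_square: "hexagon F \<Longrightarrow> \<not> square F"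
  using square_card_extreme_points by (force simp: hexagon_def)

text \<open>Every facet is generated by a coplanar triple or an orthogonal pair. As no set is both a
  hexagon and a square, the shape reveals which of the two occurs.\<close>

lemma hexagonal_facets:
  "{F. F facet_of trunc_oct \<and> hexagon F} = {F. \<exists>T\<in>coplanar_triples. generates T F}"
  using facet_generated generates_hexagon generates_square not_hexagon_square by blast

lemma square_facets:
  "{F. F facet_of trunc_oct \<and> square F} = {F. \<exists>P\<in>orth_pairs. generates P F}"
  using facet_generated generates_hexagon generates_square not_hexagon_square by blast

lemma card_generated:
  assumes "N \<subseteq> normals"
  shows "card {F. \<exists>J\<in>(\<lambda>n. perp n verts) ` N. generates J F} = 2 * card N"
proof -
  have "{F. \<exists>J\<in>(\<lambda>n. perp n verts) ` N. generates J F} = (\<Union>n\<in>N. {F. generates (perp n verts) F})"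
    by blast
  also have "\<dots> = (\<Union>n\<in>N. {face n, uminus ` face n})"
    using assms by (intro SUP_cong refl generates_normal) blast
  finally show ?thesis using card_faces[OF assms] by simp
qed

lemma card_hexagonal_facets: "card {F. F facet_of trunc_oct \<and> hexagon F} = 8"
proof -
  have "card hex_normals = 4" by (simp add: hex_normals_def vec_eq_iff forall_3 vector_3)
  then show ?thesis
    using card_generated[of hex_normals] unfolding hexagonal_facets perp_hex_normals
    by (simp add: normals_def)
qed

lemma card_square_facets: "card {F. F facet_of trunc_oct \<and> square F} = 6"
proof -
  have "card square_normals = 3" by (simp add: square_normals_def vec_eq_iff forall_3 vector_3)
  then show ?thesis
    using card_generated[of square_normals] unfolding square_facets perp_square_normals
    by (simp add: normals_def)
qed

lemma generates_opposite_pair: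
  assumes "J \<in> coplanar_triples \<union> orth_pairs"
  shows "\<exists>F. F \<noteq> uminus ` F \<and> {G. generates J G} = {F, uminus ` F}"
proof -
  obtain n where n: "n \<in> normals" "J = perp n verts"
    using assms unfolding perp_hex_normals[symmetric] perp_square_normals[symmetric] normals_def by blast
  show ?thesis
    unfolding n(2)
    by (rule exI[of _ "face n"]) (intro conjI generates_normal[OF n(1)] face_neq_uminus normals_nonzero[OF n(1)])
qed

theorem theorem8p6:
  shows
    \<comment> \<open>the pair and triple data determine the family\<close>
    "(\<forall>s :: nat \<Rightarrow> real^3.
        (\<forall>i\<in>verts. norm (s i) = 1) \<longrightarrow>
        (\<forall>i\<in>verts. \<forall>j\<in>verts. i < j \<longrightarrow> I_mom [s i, s j] = I_mom [r i, r j]) \<longrightarrow>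
        (\<forall>i\<in>verts. \<forall>j\<in>verts. \<forall>k\<in>verts. i < j \<longrightarrow> j < k \<longrightarrow>
           I_mom [s i, s j, s k] = I_mom [r i, r j, r k]) \<longrightarrow>
        (\<exists>(\<epsilon> :: nat \<Rightarrow> real) (Q :: real^3^3). orthogonal_matrix Q \<and>
           (\<forall>i\<in>verts. \<epsilon> i \<in> {1, -1} \<and> s i = \<epsilon> i *\<^sub>R (Q *v r i))))
   \<and> \<comment> \<open>what the pair data alone determine\<close>
     card orth_pairs = 3
   \<and> (\<forall>s :: nat \<Rightarrow> real^3.
        (\<forall>i\<in>verts. norm (s i) = 1) \<longrightarrow>
        (\<forall>i\<in>verts. \<forall>j\<in>verts. i < j \<longrightarrow> I_mom [s i, s j] = I_mom [r i, r j]) \<longrightarrow>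
        (\<forall>i\<in>verts. \<forall>j\<in>verts. i \<noteq> j \<longrightarrow>
           (s i \<bullet> s j = 0 \<longleftrightarrow> {i, j} \<in> orth_pairs) \<and>
           ({i, j} \<notin> orth_pairs \<longrightarrow> \<bar>s i \<bullet> s j\<bar> = 1 / 2)))
   \<and> \<comment> \<open>triangles and switching classes\<close>
     card triangles = 8
   \<and> F2_span (triangle_vec ` triangles) = cycle_space
   \<and> F2_dim cycle_space = 7
   \<and> (\<forall>i j k. {i, j, k} \<in> triangles \<longrightarrow>
        (switching_class i j k < 0 \<longleftrightarrow> dependent {r i, r j, r k}))
   \<and> coplanar_triples = {{i, j, k} | i j k. {i, j, k} \<in> triangles \<and> switching_class i j k < 0}
   \<and> card coplanar_triples = 4
   \<and> \<comment> \<open>facets\<close>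
     (\<forall>J \<in> coplanar_triples \<union> orth_pairs.
        \<exists>F. F \<noteq> uminus ` F \<and> {G. generates J G} = {F, uminus ` F})
   \<and> {F. F facet_of trunc_oct \<and> hexagon F} = {F. \<exists>T\<in>coplanar_triples. generates T F}
   \<and> card {F. F facet_of trunc_oct \<and> hexagon F} = 8
   \<and> {F. F facet_of trunc_oct \<and> square F} = {F. \<exists>P\<in>orth_pairs. generates P F}
   \<and> card {F. F facet_of trunc_oct \<and> square F} = 6"
proof (intro conjI)
  show "\<forall>i j k. {i, j, k} \<in> triangles \<longrightarrow>
      (switching_class i j k < 0 \<longleftrightarrow> dependent {r i, r j, r k})"
    by (auto simp: triangles_iff \<Gamma>_iff dependent_r_iff)
  show "\<forall>s :: nat \<Rightarrow> real^3.
      (\<forall>i\<in>verts. norm (s i) = 1) \<longrightarrow>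
      (\<forall>i\<in>verts. \<forall>j\<in>verts. i < j \<longrightarrow> I_mom [s i, s j] = I_mom [r i, r j]) \<longrightarrow>
      (\<forall>i\<in>verts. \<forall>j\<in>verts. i \<noteq> j \<longrightarrow>
         (s i \<bullet> s j = 0 \<longleftrightarrow> {i, j} \<in> orth_pairs) \<and>
         ({i, j} \<notin> orth_pairs \<longrightarrow> \<bar>s i \<bullet> s j\<bar> = 1 / 2))"
  proof (intro allI impI ballI)
    fix s :: "nat \<Rightarrow> real^3" and i j
    assume "\<forall>i\<in>verts. norm (s i) = 1"
      "\<forall>i\<in>verts. \<forall>j\<in>verts. i < j \<longrightarrow> I_mom [s i, s j] = I_mom [r i, r j]"
      "i \<in> verts" "j \<in> verts" "i \<noteq> j"
    from pair_data_abs_inner[OF this]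
    show "(s i \<bullet> s j = 0 \<longleftrightarrow> {i, j} \<in> orth_pairs) \<and>
        ({i, j} \<notin> orth_pairs \<longrightarrow> \<bar>s i \<bullet> s j\<bar> = 1 / 2)"
      by (auto split: if_splits)
  qed
  show "\<forall>J \<in> coplanar_triples \<union> orth_pairs.
      \<exists>F. F \<noteq> uminus ` F \<and> {G. generates J G} = {F, uminus ` F}"
    using generates_opposite_pair by blast
qed (rule card_orth_pairs card_triangles span_triangles dim_cycle_space coplanar_triples_switching
    card_coplanar_triples hexagonal_facets card_hexagonal_facets square_facets card_square_facets
  | use triple_data_determine in blast)+

end
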